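(* Let $p$ be a prime, let $c\geq 1$ be an integer, and let $G$ be a finite powerful $p$-group with $d(G)=d$ and $e(G)=e$. Then $$|M^{(c)}(G)|\leq p^{\chi_{c+1}(d)\,e}.$$
   Context: For a group $X$, $d(X)$ denotes the minimal number of generators of $X$, and $\mho_i(X)$ denotes the subgroup of $X$ generated by all $p^i$-th powers of elements of $X$. For a finite $p$-group $X$, $e(X)$ is the integer defined by $\exp(X)=p^{e(X)}$, where $\exp(X)$ is the exponent of $X$. A $p$-group $G$ is called powerful if $p$ is odd and $G'\leq \mho_1(G)$, or $p=2$ and $G'\leq \mho_2(G)$, where $G'=[G,G]$. For a group $G$ with a free presentation $G\cong F/R$ ($F$ a free group, $R$ a normal subgroup of $F$), the $c$-nilpotent multiplier of $G$ is the abelian group $$M^{(c)}(G)=\frac{R\cap\gamma_{c+1}(F)}{[R,{}_cF]},$$ where $\gamma_{c+1}(F)$ is the $(c+1)$-st term of the lower central series of $F$ (with $\gamma_1(F)=F$) and $[R,{}_cF]=[R,F,\ldots,F]$ with $F$ occurring $c$ times (left-normed). Up to isomorphism it does not depend on the free presentation chosen. $\chi_{n}(d)$ denotes the number of basic commutators of weight $n$ on $d$ letters (in the sense of M. Hall), i.e. $\chi_n(d)=\frac1n\sum_{m\mid n}\mu(m)d^{n/m}$ with $\mu$ the Möbius function. *)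

theory Defs
  imports "HOL-Algebra.Generated_Groups" "HOL-Computational_Algebra.Primes"
begin

subsection \<open>Free groups\<close>

text \<open>A letter \<open>(x, True)\<close> stands for the generator \<open>x\<close> and \<open>(x, False)\<close> for its inverse.
  The free group on \<open>X\<close> consists of the reduced words, multiplied by concatenation
  followed by free reduction.\<close>

definition inv_letter :: "'x \<times> bool \<Rightarrow> 'x \<times> bool" where
  "inv_letter a = (fst a, \<not> snd a)"

fun reduced :: "('x \<times> bool) list \<Rightarrow> bool" where
  "reduced [] \<longleftrightarrow> True"
| "reduced [a] \<longleftrightarrow> True"
| "reduced (a # b # w) \<longleftrightarrow> b \<noteq> inv_letter a \<and> reduced (b # w)"

fun rcons :: "'x \<times> bool \<Rightarrow> ('x \<times> bool) list \<Rightarrow> ('x \<times> bool) list" where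
  "rcons a [] = [a]"
| "rcons a (b # w) = (if b = inv_letter a then w else a # b # w)"

definition free_group :: "'x set \<Rightarrow> ('x \<times> bool) list monoid" where
  "free_group X = \<lparr>carrier = {w. reduced w \<and> set w \<subseteq> X \<times> UNIV},
                   monoid.mult = (\<lambda>u v. foldr rcons u v),
                   one = []\<rparr>"

lemma inv_letter_inv_letter [simp]: "inv_letter (inv_letter a) = a"
  by (simp add: inv_letter_def)

lemma fst_inv_letter [simp]: "fst (inv_letter a) = fst a"
  by (simp add: inv_letter_def)

lemma inv_letter_neq [simp]: "inv_letter a \<noteq> a" "a \<noteq> inv_letter a"
  by (simp_all add: inv_letter_def prod_eq_iff)

lemma inv_letter_in [simp]: "inv_letter a \<in> X \<times> UNIV \<longleftrightarrow> a \<in> X \<times> UNIV"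
  by (cases a) (simp add: inv_letter_def)

lemma reduced_ConsD: "reduced (a # w) \<Longrightarrow> reduced w"
  by (cases w) auto

lemma reduced_rcons: "reduced w \<Longrightarrow> reduced (rcons a w)"
  by (cases w) (auto dest: reduced_ConsD)

lemma rcons_reduced: "reduced (a # w) \<Longrightarrow> rcons a w = a # w"
  by (cases w) auto

lemma rcons_cancel: "reduced w \<Longrightarrow> rcons (inv_letter a) (rcons a w) = w"
  by (cases w) (auto simp: rcons_reduced)

lemma set_rcons: "set (rcons a w) \<subseteq> insert a (set w)"
  by (cases w) auto

lemma reduced_foldr: "reduced w \<Longrightarrow> reduced (foldr rcons u w)"
  by (induction u) (auto intro: reduced_rcons)

lemma set_foldr_rcons: "set (foldr rcons u w) \<subseteq> set u \<union> set w"
proof (induction u)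
  case (Cons a u)
  then show ?case using set_rcons[of a "foldr rcons u w"] by auto
qed simp

lemma foldr_rcons_rcons:
  assumes "reduced w"
  shows "foldr rcons (rcons a v) w = rcons a (foldr rcons v w)"
proof (cases v)
  case (Cons b v')
  show ?thesis
  proof (cases "b = inv_letter a")
    case True
    have "rcons (inv_letter b) (rcons b (foldr rcons v' w)) = foldr rcons v' w"
      using assms by (intro rcons_cancel reduced_foldr)
    then show ?thesis using Cons True by simp
  qed (simp add: Cons)
qed simp

lemma foldr_rcons_assoc:
  "reduced w \<Longrightarrow> foldr rcons (foldr rcons u v) w = foldr rcons u (foldr rcons v w)"
  by (induction u) (simp_all add: foldr_rcons_rcons)

lemma foldr_rcons_Nil: "reduced u \<Longrightarrow> foldr rcons u [] = u"
proof (induction u)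
  case (Cons a u)
  then have "foldr rcons u [] = u" by (blast dest: reduced_ConsD)
  then show ?case using Cons.prems by (simp add: rcons_reduced)
qed simp

lemma foldr_rcons_inverse: "foldr rcons (map inv_letter (rev u)) (foldr rcons u []) = []"
proof (induction u)
  case (Cons a u)
  have "rcons (inv_letter a) (rcons a (foldr rcons u [])) = foldr rcons u []"
    by (intro rcons_cancel reduced_foldr) simp
  then show ?case using Cons by simp
qed simp

lemma group_free_group: "group (free_group X)"
proof (rule groupI)
  fix u assume u: "u \<in> carrier (free_group X)"
  define v where "v = foldr rcons (map inv_letter (rev u)) []"
  have "set (map inv_letter (rev u)) \<subseteq> X \<times> UNIV"
    using u by (auto simp: free_group_def inv_letter_def)
  then have "v \<in> carrier (free_group X)"
    using set_foldr_rcons[of "map inv_letter (rev u)" "[]"]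
    by (auto simp: v_def free_group_def reduced_foldr)
  moreover have "v \<otimes>\<^bsub>free_group X\<^esub> u = \<one>\<^bsub>free_group X\<^esub>"
    using u foldr_rcons_inverse[of u]
    by (simp add: v_def free_group_def foldr_rcons_assoc foldr_rcons_Nil)
  ultimately show "\<exists>v\<in>carrier (free_group X). v \<otimes>\<^bsub>free_group X\<^esub> u = \<one>\<^bsub>free_group X\<^esub>" ..
next
  fix u v assume "u \<in> carrier (free_group X)" "v \<in> carrier (free_group X)"
  then show "u \<otimes>\<^bsub>free_group X\<^esub> v \<in> carrier (free_group X)"
    using set_foldr_rcons[of u v] by (auto simp: free_group_def reduced_foldr)
qed (auto simp: free_group_def foldr_rcons_assoc)

text \<open>\<open>F\<close> is free of rank \<open>|X|\<close> (any cardinality) and \<open>G \<cong> F/R\<close>.\<close>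

definition free_presentation ::
    "'x set \<Rightarrow> ('f, 'm) monoid_scheme \<Rightarrow> 'f set \<Rightarrow> ('g, 'n) monoid_scheme \<Rightarrow> bool" where
  "free_presentation X F R G \<longleftrightarrow> group F \<and> F \<cong> free_group X \<and> R \<lhd> F \<and> F Mod R \<cong> G"

primrec eval_word :: "('g, 'n) monoid_scheme \<Rightarrow> ('g \<times> bool) list \<Rightarrow> 'g" where
  "eval_word G [] = \<one>\<^bsub>G\<^esub>"
| "eval_word G (a # w) = (if snd a then fst a else inv\<^bsub>G\<^esub> (fst a)) \<otimes>\<^bsub>G\<^esub> eval_word G w"

lemma (in group) eval_word_closed:
  "set w \<subseteq> carrier G \<times> UNIV \<Longrightarrow> eval_word G w \<in> carrier G"
  by (induction w) auto

lemma (in group) eval_word_rcons: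
  assumes "set (a # w) \<subseteq> carrier G \<times> UNIV"
  shows "eval_word G (rcons a w) = eval_word G (a # w)"
proof (cases w)
  case (Cons b w')
  then have "fst a \<in> carrier G" "eval_word G w' \<in> carrier G"
    using assms by (auto intro!: eval_word_closed)
  then show ?thesis
    using Cons by (auto simp: inv_letter_def m_assoc[symmetric])
qed simp

lemma (in group) eval_word_foldr:
  assumes "set u \<subseteq> carrier G \<times> UNIV" "set v \<subseteq> carrier G \<times> UNIV"
  shows "eval_word G (foldr rcons u v) = eval_word G u \<otimes> eval_word G v"
  using assms(1)
proof (induction u)
  case (Cons a u)
  have "set (a # foldr rcons u v) \<subseteq> carrier G \<times> UNIV"
    using Cons.prems assms(2) set_foldr_rcons[of u v] by auto
  then show ?case
    using Cons assms(2) by (auto simp: eval_word_rcons m_assoc eval_word_closed)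
qed (simp add: eval_word_closed assms(2))

lemma (in group) ex_free_presentation:
  "\<exists>R. free_presentation (carrier G) (free_group (carrier G)) R G"
proof -
  let ?F = "free_group (carrier G)"
  have F: "group ?F" by (rule group_free_group)
  have "eval_word G \<in> hom ?F G"
    by (intro homI) (auto simp: free_group_def eval_word_closed eval_word_foldr)
  then interpret ev: group_hom ?F G "eval_word G"
    using F is_group by (simp add: group_hom_def group_hom_axioms_def)
  have "eval_word G ` carrier ?F = carrier G"
  proof
    show "carrier G \<subseteq> eval_word G ` carrier ?F"
    proof
      fix x assume "x \<in> carrier G"
      then show "x \<in> eval_word G ` carrier ?F"
        by (intro image_eqI[of _ _ "[(x, True)]"]) (auto simp: free_group_def)
    qed
  qed auto
  then have "?F Mod kernel ?F G (eval_word G) \<cong> G"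
    by (rule ev.FactGroup_iso)
  then show ?thesis
    using F ev.normal_kernel iso_set_refl unfolding free_presentation_def is_iso_def by blast
qed


subsection \<open>Commutator subgroups and the nilpotent multiplier\<close>

text \<open>\<open>comm_subgroup G H H\<close> is the library's \<open>derived G H\<close>.\<close>

definition comm_subgroup :: "('a, 'm) monoid_scheme \<Rightarrow> 'a set \<Rightarrow> 'a set \<Rightarrow> 'a set" where
  "comm_subgroup G H K =
     generate G (\<Union>h\<in>H. \<Union>k\<in>K. {h \<otimes>\<^bsub>G\<^esub> k \<otimes>\<^bsub>G\<^esub> inv\<^bsub>G\<^esub> h \<otimes>\<^bsub>G\<^esub> inv\<^bsub>G\<^esub> k})"

text \<open>\<open>iter_comm G H n\<close> is the left-normed \<open>[H, G, \<dots>, G]\<close> with \<open>n\<close> copies of \<open>G\<close>.\<close>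

primrec iter_comm :: "('a, 'm) monoid_scheme \<Rightarrow> 'a set \<Rightarrow> nat \<Rightarrow> 'a set" where
  "iter_comm G H 0 = H"
| "iter_comm G H (Suc n) = comm_subgroup G (iter_comm G H n) (carrier G)"

text \<open>Indexed from 1: the first term is the whole group. The value at 0 is irrelevant.\<close>

definition lower_central :: "('a, 'm) monoid_scheme \<Rightarrow> nat \<Rightarrow> 'a set" where
  "lower_central G n = iter_comm G (carrier G) (n - 1)"

text \<open>For a free presentation \<open>G \<cong> F/R\<close> this is the \<open>c\<close>-nilpotent multiplier of \<open>G\<close>.\<close>

definition nilpotent_multiplier ::
    "('f, 'm) monoid_scheme \<Rightarrow> 'f set \<Rightarrow> nat \<Rightarrow> 'f set monoid" where
  "nilpotent_multiplier F R c =
     (F\<lparr>carrier := R \<inter> lower_central F (c + 1)\<rparr>) Mod (iter_comm F R c)"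


subsection \<open>Powerful \<open>p\<close>-groups\<close>

definition min_generators :: "('a, 'm) monoid_scheme \<Rightarrow> nat" where
  "min_generators G =
     (LEAST n. \<exists>S. S \<subseteq> carrier G \<and> finite S \<and> card S = n \<and> generate G S = carrier G)"

definition group_exp :: "('a, 'm) monoid_scheme \<Rightarrow> nat" where
  "group_exp G = (LEAST n. 0 < n \<and> (\<forall>x\<in>carrier G. x [^]\<^bsub>G\<^esub> n = \<one>\<^bsub>G\<^esub>))"

definition agemo :: "nat \<Rightarrow> nat \<Rightarrow> ('a, 'm) monoid_scheme \<Rightarrow> 'a set" where
  "agemo p i G = generate G {x [^]\<^bsub>G\<^esub> (p ^ i) | x. x \<in> carrier G}"

definition finite_p_group :: "nat \<Rightarrow> ('a, 'm) monoid_scheme \<Rightarrow> bool" where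
  "finite_p_group p G \<longleftrightarrow> group G \<and> finite (carrier G) \<and> (\<exists>k. order G = p ^ k)"

definition powerful :: "nat \<Rightarrow> ('a, 'm) monoid_scheme \<Rightarrow> bool" where
  "powerful p G \<longleftrightarrow>
     (odd p \<and> derived G (carrier G) \<subseteq> agemo p 1 G) \<or>
     (p = 2 \<and> derived G (carrier G) \<subseteq> agemo p 2 G)"


subsection \<open>Basic commutators\<close>

datatype comm = Letter nat | Comm comm comm

primrec weight :: "comm \<Rightarrow> nat" where
  "weight (Letter i) = 1"
| "weight (Comm u v) = weight u + weight v"

text \<open>M. Hall's definition orders the basic commutators by weight, and arbitrarily within a
  given weight; the number of basic commutators does not depend on that choice. Here letters
  are ordered by index, and commutators of equal weight lexicographically.\<close>

fun comm_less :: "comm \<Rightarrow> comm \<Rightarrow> bool" where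
  "comm_less (Letter i) (Letter j) \<longleftrightarrow> i < j"
| "comm_less (Letter i) (Comm u v) \<longleftrightarrow> True"
| "comm_less (Comm u v) (Letter i) \<longleftrightarrow> False"
| "comm_less (Comm u v) (Comm u' v') \<longleftrightarrow>
     weight (Comm u v) < weight (Comm u' v') \<or>
     weight (Comm u v) = weight (Comm u' v') \<and>
       (comm_less u u' \<or> u = u' \<and> comm_less v v')"

text \<open>\<open>[u, v]\<close> is basic iff \<open>u\<close> and \<open>v\<close> are basic, \<open>u > v\<close>, and \<open>v \<ge> t\<close> whenever
  \<open>u = [s, t]\<close>.\<close>

fun basic_comm :: "nat \<Rightarrow> comm \<Rightarrow> bool" where
  "basic_comm d (Letter i) \<longleftrightarrow> i < d"
| "basic_comm d (Comm u v) \<longleftrightarrow>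
     basic_comm d u \<and> basic_comm d v \<and> comm_less v u \<and>
     (case u of Letter i \<Rightarrow> True | Comm s t \<Rightarrow> t = v \<or> comm_less t v)"

definition num_basic_comms :: "nat \<Rightarrow> nat \<Rightarrow> nat" where
  "num_basic_comms n d = card {w. basic_comm d w \<and> weight w = n}"

lemma weight_pos: "0 < weight w"
  by (induction w) auto

lemma finite_basic_comms: "finite {w. basic_comm d w \<and> weight w = n}"
proof (induction n rule: less_induct)
  case (less n)
  define B where "B = (\<Union>m<n. {w. basic_comm d w \<and> weight w = m})"
  have "finite B" using less unfolding B_def by blast
  moreover have "{w. basic_comm d w \<and> weight w = n}
      \<subseteq> Letter ` {..<d} \<union> (\<lambda>(u, v). Comm u v) ` (B \<times> B)"
  proof
    fix w assume w: "w \<in> {w. basic_comm d w \<and> weight w = n}"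
    show "w \<in> Letter ` {..<d} \<union> (\<lambda>(u, v). Comm u v) ` (B \<times> B)"
    proof (cases w)
      case (Comm u v)
      then have "u \<in> B" "v \<in> B"
        using w weight_pos[of u] weight_pos[of v] by (auto simp: B_def)
      then show ?thesis using Comm by auto
    qed (use w in auto)
  qed
  ultimately show ?case
    by (meson finite_SigmaI finite_UnI finite_imageI finite_lessThan finite_subset)
qed

end

theory Submission
  imports Defs "HOL-Algebra.Group_Action" "HOL-Algebra.Multiplicative_Group"
begin

text \<open>
  Let \<open>\<phi>\<close> be the projection from \<open>F\<close> onto \<open>G\<close> with kernel \<open>R\<close>, let
  \<open>G = G\<^sub>0 \<ge> G\<^sub>1 \<ge> \<dots>\<close> be the series in which \<open>G\<^sub>i\<^sub>+\<^sub>1\<close> is generated by the \<open>p\<close>-th powers of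
  elements of \<open>G\<^sub>i\<close>, and let \<open>N\<^sub>i = [\<phi>\<^sup>-\<^sup>1(G\<^sub>i), F, \<dots>, F]\<close> with \<open>c\<close> copies of \<open>F\<close>. Then \<open>N\<^sub>0\<close> is
  \<open>\<gamma>\<^sub>c\<^sub>+\<^sub>1(F)\<close>, and since \<open>G\<^sub>e\<close> is trivial (\<open>power_series_trivial\<close>) \<open>N\<^sub>e\<close> is \<open>[R, F, \<dots>, F]\<close>. The
  multiplier is therefore contained in \<open>N\<^sub>0/N\<^sub>e\<close>, and it suffices to show that each of the \<open>e\<close>
  factors \<open>N\<^sub>i/N\<^sub>i\<^sub>+\<^sub>1\<close> has order at most \<open>p\<close> to the number of basic commutators of weight \<open>c + 1\<close>.

  The factors do not grow with \<open>i\<close>, because the \<open>p\<close>-th power map induces a surjection from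
  \<open>N\<^sub>i/N\<^sub>i\<^sub>+\<^sub>1\<close> onto \<open>N\<^sub>i\<^sub>+\<^sub>1/N\<^sub>i\<^sub>+\<^sub>2\<close>. In \<open>G\<close> itself, that is for \<open>c = 0\<close>, this is the theory of
  powerful groups of Lubotzky and Mann (\<open>powerful_p_filtration\<close>). The properties of the series
  that make it work are collected in the locale \<open>p_filtration\<close>; they lift from \<open>G\<close> to \<open>F\<close>, and
  they pass from a series \<open>A\<^sub>i\<close> to the series \<open>[A\<^sub>i, F]\<close> (\<open>p_filtration_comm_subgroup\<close>), so that
  induction on \<open>c\<close> applies.

  The first factor is \<open>\<gamma>\<^sub>c\<^sub>+\<^sub>1(F) / [K, F, \<dots>, F]\<close> for \<open>K = \<phi>\<^sup>-\<^sup>1(G\<^sub>1)\<close>. As \<open>F/K\<close> is abelian and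
  generated by \<open>d\<close> elements, the quotients \<open>\<gamma>\<^sub>n(F) / [K, F, \<dots>, F]\<close> with \<open>n - 1\<close> copies of \<open>F\<close> are
  the homogeneous components of a Lie ring generated by \<open>d\<close> elements of degree one. There the
  basic commutators of weight \<open>n\<close> span the component of degree \<open>n\<close>
  (\<open>lower_central_subset_basic_span\<close>). The exponent of the first factor divides \<open>p\<close>, which gives the
  bound.
\<close>

section \<open>Commutators\<close>

text \<open>Comments write \<open>[x, y]\<close> for this commutator.\<close>
definition commutator :: "('a, 'm) monoid_scheme \<Rightarrow> 'a \<Rightarrow> 'a \<Rightarrow> 'a" (\<open>\<langle>_, _\<rangle>\<index>\<close>) where
  "\<langle>x, y\<rangle>\<^bsub>G\<^esub> = x \<otimes>\<^bsub>G\<^esub> y \<otimes>\<^bsub>G\<^esub> inv\<^bsub>G\<^esub> x \<otimes>\<^bsub>G\<^esub> inv\<^bsub>G\<^esub> y"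

context group
begin

lemma inv_cancel_left [simp]: "x \<in> carrier G \<Longrightarrow> y \<in> carrier G \<Longrightarrow> inv x \<otimes> (x \<otimes> y) = y"
  by (simp add: m_assoc[symmetric])

lemma cancel_inv_left [simp]: "x \<in> carrier G \<Longrightarrow> y \<in> carrier G \<Longrightarrow> x \<otimes> (inv x \<otimes> y) = y"
  by (simp add: m_assoc[symmetric])

lemma commutator_closed [simp, intro]:
  "x \<in> carrier G \<Longrightarrow> y \<in> carrier G \<Longrightarrow> \<langle>x, y\<rangle> \<in> carrier G"
  by (simp add: commutator_def)

lemmas word_simps = commutator_def m_assoc inv_mult_group

lemma inv_commutator: "x \<in> carrier G \<Longrightarrow> y \<in> carrier G \<Longrightarrow> inv \<langle>x, y\<rangle> = \<langle>y, x\<rangle>"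
  by (simp add: word_simps)

lemma commutator_self [simp]: "x \<in> carrier G \<Longrightarrow> \<langle>x, x\<rangle> = \<one>"
  by (simp add: word_simps)

lemma commutator_one_left [simp]: "x \<in> carrier G \<Longrightarrow> \<langle>\<one>, x\<rangle> = \<one>"
  by (simp add: word_simps)

lemma commutator_mult_left:
  assumes "x \<in> carrier G" "y \<in> carrier G" "z \<in> carrier G"
  shows "\<langle>x \<otimes> y, z\<rangle> = x \<otimes> \<langle>y, z\<rangle> \<otimes> inv x \<otimes> \<langle>x, z\<rangle>"
  using assms by (simp add: word_simps)

lemma commutator_inv_left:
  assumes "x \<in> carrier G" "z \<in> carrier G"
  shows "\<langle>inv x, z\<rangle> = inv x \<otimes> inv \<langle>x, z\<rangle> \<otimes> x"
  using assms by (simp add: word_simps)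

lemma commutator_conj:
  assumes "x \<in> carrier G" "y \<in> carrier G" "g \<in> carrier G"
  shows "g \<otimes> \<langle>x, y\<rangle> \<otimes> inv g = \<langle>g \<otimes> x \<otimes> inv g, g \<otimes> y \<otimes> inv g\<rangle>"
  using assms by (simp add: word_simps)

lemma Hall_Witt:
  assumes "x \<in> carrier G" "y \<in> carrier G" "z \<in> carrier G"
  shows "\<langle>\<langle>x, y\<rangle>, y \<otimes> z \<otimes> inv y\<rangle> \<otimes> \<langle>\<langle>y, z\<rangle>, z \<otimes> x \<otimes> inv z\<rangle> \<otimes> \<langle>\<langle>z, x\<rangle>, x \<otimes> y \<otimes> inv x\<rangle> = \<one>"
  using assms by (simp add: word_simps)

lemma commutator_eq_one_iff:
  assumes "x \<in> carrier G" "y \<in> carrier G"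
  shows "\<langle>x, y\<rangle> = \<one> \<longleftrightarrow> x \<otimes> y = y \<otimes> x"
proof
  assume "\<langle>x, y\<rangle> = \<one>"
  then have "\<langle>x, y\<rangle> \<otimes> (y \<otimes> x) = y \<otimes> x" using assms by simp
  then show "x \<otimes> y = y \<otimes> x" using assms by (simp add: word_simps)
next
  assume "x \<otimes> y = y \<otimes> x"
  then show "\<langle>x, y\<rangle> = \<one>" using assms by (simp add: commutator_def) (simp add: word_simps)
qed

lemma nat_pow_conj:
  assumes "x \<in> carrier G" "g \<in> carrier G"
  shows "(g \<otimes> x \<otimes> inv g) [^] (n::nat) = g \<otimes> x [^] n \<otimes> inv g"
  by (induction n) (use assms in \<open>simp_all add: m_assoc\<close>)

lemma nat_pow_commute:
  assumes "x \<in> carrier G" "y \<in> carrier G" "x \<otimes> y = y \<otimes> x"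
  shows "x [^] (n::nat) \<otimes> y = y \<otimes> x [^] n"
proof (induction n)
  case (Suc n)
  have "x [^] Suc n \<otimes> y = x [^] n \<otimes> (y \<otimes> x)" using assms by (simp add: m_assoc)
  also have "\<dots> = y \<otimes> x [^] Suc n" using assms Suc by (simp add: m_assoc[symmetric])
  finally show ?case .
qed (use assms in simp)

lemma nat_pow_swap:
  assumes "x \<in> carrier G" "y \<in> carrier G"
    and "\<langle>y, x\<rangle> \<otimes> x = x \<otimes> \<langle>y, x\<rangle>" "\<langle>y, x\<rangle> \<otimes> y = y \<otimes> \<langle>y, x\<rangle>"
  shows "y [^] (n::nat) \<otimes> x = x \<otimes> y [^] n \<otimes> \<langle>y, x\<rangle> [^] n"
proof (induction n)
  case (Suc n)
  let ?c = "\<langle>y, x\<rangle>"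
  have c: "?c \<in> carrier G" using assms by simp
  have yx: "y \<otimes> x = x \<otimes> y \<otimes> ?c"
  proof -
    have "y \<otimes> x = ?c \<otimes> x \<otimes> y" using assms(1,2) by (simp add: word_simps)
    also have "\<dots> = x \<otimes> (?c \<otimes> y)" using assms by (simp add: m_assoc)
    finally show ?thesis using assms c by (simp add: m_assoc)
  qed
  have cy: "?c \<otimes> y [^] n = y [^] n \<otimes> ?c"
    using nat_pow_commute[of y ?c n] assms c by simp
  have "y [^] Suc n \<otimes> x = y [^] n \<otimes> (y \<otimes> x)" using assms by (simp add: m_assoc)
  also have "\<dots> = (y [^] n \<otimes> x) \<otimes> (y \<otimes> ?c)" using assms c yx by (simp add: m_assoc)
  also have "\<dots> = x \<otimes> y [^] n \<otimes> (?c [^] n \<otimes> y) \<otimes> ?c" using assms c Suc by (simp add: m_assoc)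
  also have "\<dots> = x \<otimes> y [^] n \<otimes> (y \<otimes> ?c [^] n) \<otimes> ?c"
    using nat_pow_commute[of ?c y n] assms c by simp
  also have "\<dots> = x \<otimes> y [^] Suc n \<otimes> ?c [^] Suc n" using assms c by (simp add: m_assoc)
  finally show ?case .
qed (use assms in simp)

text \<open>Sorting the word \<open>(x y)\<^sup>n\<close> moves a letter \<open>x\<close> leftwards past a letter \<open>y\<close> exactly
  \<open>n choose 2\<close> times, and each move leaves behind one central factor \<open>[y, x]\<close>.\<close>

lemma nat_pow_mult_class2:
  assumes "x \<in> carrier G" "y \<in> carrier G"
    and "\<langle>y, x\<rangle> \<otimes> x = x \<otimes> \<langle>y, x\<rangle>" "\<langle>y, x\<rangle> \<otimes> y = y \<otimes> \<langle>y, x\<rangle>"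
  shows "(x \<otimes> y) [^] (n::nat) = x [^] n \<otimes> y [^] n \<otimes> \<langle>y, x\<rangle> [^] (n choose 2)"
proof (induction n)
  case (Suc n)
  let ?c = "\<langle>y, x\<rangle>"
  have c: "?c \<in> carrier G" using assms by simp
  have "(x \<otimes> y) [^] Suc n = x [^] n \<otimes> y [^] n \<otimes> (?c [^] (n choose 2) \<otimes> x) \<otimes> y"
    using assms c Suc by (simp add: m_assoc)
  also have "\<dots> = x [^] n \<otimes> (y [^] n \<otimes> x) \<otimes> (?c [^] (n choose 2) \<otimes> y)"
    using nat_pow_commute[of ?c x "n choose 2"] assms c by (simp add: m_assoc)
  also have "\<dots> = x [^] n \<otimes> (x \<otimes> y [^] n \<otimes> ?c [^] n) \<otimes> (y \<otimes> ?c [^] (n choose 2))"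
    using nat_pow_swap[OF assms, of n] nat_pow_commute[of ?c y "n choose 2"] assms c by simp
  also have "\<dots> = x [^] Suc n \<otimes> y [^] n \<otimes> (?c [^] n \<otimes> y) \<otimes> ?c [^] (n choose 2)"
    using assms c by (simp add: m_assoc)
  also have "\<dots> = x [^] Suc n \<otimes> y [^] n \<otimes> (y \<otimes> ?c [^] n) \<otimes> ?c [^] (n choose 2)"
    using nat_pow_commute[of ?c y n] assms c by simp
  also have "\<dots> = x [^] Suc n \<otimes> y [^] Suc n \<otimes> ?c [^] (n + (n choose 2))"
    using assms c by (simp add: m_assoc nat_pow_mult[symmetric])
  also have "n + (n choose 2) = Suc n choose 2"
    by (simp add: numeral_2_eq_2)
  finally show ?case .
qed (use assms in \<open>simp add: numeral_2_eq_2\<close>)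

lemma commutator_pow_left:
  assumes "x \<in> carrier G" "y \<in> carrier G" "\<langle>x, y\<rangle> \<otimes> x = x \<otimes> \<langle>x, y\<rangle>"
  shows "\<langle>x [^] (n::nat), y\<rangle> = \<langle>x, y\<rangle> [^] n"
proof (induction n)
  case (Suc n)
  let ?c = "\<langle>x, y\<rangle>"
  have c: "?c \<in> carrier G" using assms by simp
  have "\<langle>x [^] Suc n, y\<rangle> = x [^] n \<otimes> ?c \<otimes> inv (x [^] n) \<otimes> ?c [^] n"
    using assms Suc by (simp add: commutator_mult_left)
  also have "x [^] n \<otimes> ?c = ?c \<otimes> x [^] n"
    using nat_pow_commute[of x ?c n] assms c by simp
  also have "?c \<otimes> x [^] n \<otimes> inv (x [^] n) \<otimes> ?c [^] n = ?c [^] Suc n"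
    using assms c by (simp add: m_assoc nat_pow_Suc2[symmetric] del: nat_pow_Suc)
  finally show ?case .
qed (use assms in simp)

end

subsection \<open>Commutators of normal subgroups\<close>

lemma comm_subgroup_eq:
  "comm_subgroup G H K = generate G {\<langle>h, k\<rangle>\<^bsub>G\<^esub> | h k. h \<in> H \<and> k \<in> K}"
  unfolding comm_subgroup_def commutator_def by (rule arg_cong[of _ _ "generate G"]) blast

context normal
begin

lemma commutator_in [intro]: "x \<in> H \<Longrightarrow> g \<in> carrier G \<Longrightarrow> \<langle>x, g\<rangle> \<in> H"
proof -
  assume x: "x \<in> H" and g: "g \<in> carrier G"
  then have "x \<otimes> (g \<otimes> inv x \<otimes> inv g) \<in> H" using subgroup.m_closed[OF subgroup_axioms x] inv_op_closed2[OF g] by auto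
  then show ?thesis using x g by (simp add: commutator_def m_assoc)
qed

lemma commutator_swap_in:
  "x \<in> carrier G \<Longrightarrow> y \<in> carrier G \<Longrightarrow> \<langle>x, y\<rangle> \<in> H \<Longrightarrow> \<langle>y, x\<rangle> \<in> H"
  using inv_commutator[of x y] by (metis m_inv_closed)

lemma nat_pow_in: "x \<in> H \<Longrightarrow> x [^] (n::nat) \<in> H"
  by (induction n) auto

lemma quotient_group_hom: "group_hom G (G Mod H) ((#>) H)"
  using r_coset_hom_Mod factorgroup_is_group is_group
  by (simp add: group_hom_def group_hom_axioms_def)

lemma coset_eq_iff:
  assumes "x \<in> carrier G" "y \<in> carrier G"
  shows "H #> x = H #> y \<longleftrightarrow> x \<otimes> inv y \<in> H"
proof
  assume "H #> x = H #> y"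
  then have "x \<in> H #> y" using assms rcos_self[OF assms(1) subgroup_axioms] by simp
  then show "x \<otimes> inv y \<in> H" using assms rcos_module[OF is_group, of y x] by simp
next
  assume "x \<otimes> inv y \<in> H"
  then have "x \<in> H #> y" using assms rcos_module[OF is_group, of y x] by simp
  then show "H #> x = H #> y" using assms repr_independence[OF _ _ subgroup_axioms] by auto
qed

lemma coset_eq_one_iff:
  assumes "x \<in> carrier G"
  shows "H #> x = H \<longleftrightarrow> x \<in> H"
  using coset_eq_iff[OF assms one_closed] assms by (simp add: coset_mult_one subset)

sublocale Q: group_hom G "G Mod H" "(#>) H"
  by (rule quotient_group_hom)

lemma coset_commutator:
  assumes "x \<in> carrier G" "y \<in> carrier G"
  shows "H #> \<langle>x, y\<rangle> = \<langle>H #> x, H #> y\<rangle>\<^bsub>G Mod H\<^esub>"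
  using assms by (simp add: commutator_def del: mult_FactGroup)

lemma coset_commute_iff:
  assumes "x \<in> carrier G" "y \<in> carrier G"
  shows "(H #> x) \<otimes>\<^bsub>G Mod H\<^esub> (H #> y) = (H #> y) \<otimes>\<^bsub>G Mod H\<^esub> (H #> x) \<longleftrightarrow> \<langle>x, y\<rangle> \<in> H"
  using Q.H.commutator_eq_one_iff[of "H #> x" "H #> y"] coset_commutator[OF assms]
    coset_eq_one_iff[of "\<langle>x, y\<rangle>"] assms by (simp del: mult_FactGroup)

subsection \<open>Powers modulo a normal subgroup\<close>

text \<open>The error term \<open>[y, x] [^] (p choose 2)\<close> of the class-two formula vanishes modulo \<open>H\<close>: its
  exponent is a multiple of \<open>p\<close> when \<open>p\<close> is odd but equals \<open>1\<close> when \<open>p = 2\<close>; this is the source of every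
  case distinction between odd and even \<open>p\<close> below.\<close>
lemma coset_pow_prime:
  fixes p :: nat
  assumes p: "Factorial_Ring.prime p" and x: "x \<in> carrier G" and y: "y \<in> carrier G"
    and "\<langle>\<langle>y, x\<rangle>, x\<rangle> \<in> H" "\<langle>\<langle>y, x\<rangle>, y\<rangle> \<in> H" "\<langle>y, x\<rangle> [^] p \<in> H"
    and two: "p = 2 \<Longrightarrow> \<langle>y, x\<rangle> \<in> H"
  shows "H #> (x \<otimes> y) [^] p = H #> (x [^] p \<otimes> y [^] p)"
proof -
  let ?c = "\<langle>y, x\<rangle>" and ?Q = "G Mod H"
  have c: "?c \<in> carrier G" using x y by simp
  have "?c [^] (p choose 2) \<in> H"
  proof (cases "p = 2")
    case True
    then show ?thesis using two by (simp add: nat_pow_in)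
  next
    case False
    then have "2 < p" using prime_gt_1_nat[OF p] by simp
    then have "p dvd p choose 2" using p by (intro dvd_choose_prime) auto
    then obtain m where "p choose 2 = p * m" by blast
    then show ?thesis using assms(6) c by (simp add: nat_pow_pow[symmetric] nat_pow_in)
  qed
  then have "H #> (?c [^] (p choose 2)) = \<one>\<^bsub>?Q\<^esub>"
    using c by (simp add: coset_eq_one_iff)
  then have cQ: "\<langle>H #> y, H #> x\<rangle>\<^bsub>?Q\<^esub> [^]\<^bsub>?Q\<^esub> (p choose 2) = \<one>\<^bsub>?Q\<^esub>"
    using c x y by (simp add: Q.hom_nat_pow coset_commutator)
  have "((H #> x) \<otimes>\<^bsub>?Q\<^esub> (H #> y)) [^]\<^bsub>?Q\<^esub> p
      = (H #> x) [^]\<^bsub>?Q\<^esub> p \<otimes>\<^bsub>?Q\<^esub> (H #> y) [^]\<^bsub>?Q\<^esub> p \<otimes>\<^bsub>?Q\<^esub> \<langle>H #> y, H #> x\<rangle>\<^bsub>?Q\<^esub> [^]\<^bsub>?Q\<^esub> (p choose 2)"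
    using assms coset_commute_iff[OF c x] coset_commute_iff[OF c y] x y
    by (intro Q.H.nat_pow_mult_class2) (simp_all add: coset_commutator del: mult_FactGroup)
  then show ?thesis
    using x y cQ by (simp add: Q.hom_nat_pow del: mult_FactGroup one_FactGroup)
qed

text \<open>Where the power map is additive modulo \<open>H\<close>, its image and the preimages of subgroups are
  subgroups. Hence statements about powers need only be checked on generators.\<close>
lemma powers_mod_subgroup:
  fixes n :: nat
  assumes N: "subgroup N G"
    and hom: "\<And>x y. x \<in> N \<Longrightarrow> y \<in> N \<Longrightarrow> H #> (x \<otimes> y) [^] n = H #> (x [^] n \<otimes> y [^] n)"
  shows "subgroup {x \<in> carrier G. \<exists>w\<in>N. H #> x = H #> w [^] n} G" (is "subgroup ?S G")
proof (rule subgroupI)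
  have "\<one> \<in> ?S" using subgroup.one_closed[OF N] by (auto intro!: bexI[of _ \<one>])
  then show "?S \<noteq> {}" by blast
next
  fix x assume "x \<in> ?S"
  then obtain w where x: "x \<in> carrier G" and w: "w \<in> N" "H #> x = H #> w [^] n" by blast
  have wG: "w \<in> carrier G" using subgroup.mem_carrier[OF N] w by simp
  have "H #> inv x = H #> (inv w) [^] n"
    using w(2) x wG Q.hom_inv[of x] Q.hom_inv[of "w [^] n"] by (simp add: nat_pow_inv)
  then show "inv x \<in> ?S" using x w subgroup.m_inv_closed[OF N] by blast
next
  fix x y assume "x \<in> ?S" "y \<in> ?S"
  then obtain v w where x: "x \<in> carrier G" "y \<in> carrier G"
    and w: "v \<in> N" "H #> x = H #> v [^] n" "w \<in> N" "H #> y = H #> w [^] n" by blast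
  have wG: "v \<in> carrier G" "w \<in> carrier G" using subgroup.mem_carrier[OF N] w by simp_all
  have "H #> (x \<otimes> y) = H #> (v \<otimes> w) [^] n"
    using w x wG hom[OF w(1,3)] Q.hom_mult[of x y] Q.hom_mult[of "v [^] n" "w [^] n"] by simp
  then show "x \<otimes> y \<in> ?S" using x w subgroup.m_closed[OF N] by blast
qed blast

lemma power_preimage_subgroup:
  fixes n :: nat
  assumes N: "subgroup N G" and D: "subgroup D G" and "H \<subseteq> D"
    and hom: "\<And>x y. x \<in> N \<Longrightarrow> y \<in> N \<Longrightarrow> H #> (x \<otimes> y) [^] n = H #> (x [^] n \<otimes> y [^] n)"
  shows "subgroup {w \<in> N. w [^] n \<in> D} G" (is "subgroup ?S G")
proof (rule subgroupI)
  show "?S \<subseteq> carrier G" using subgroup.subset[OF N] by blast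
  show "?S \<noteq> {}" using subgroup.one_closed[OF N] subgroup.one_closed[OF D] by force
next
  fix w assume "w \<in> ?S"
  then show "inv w \<in> ?S"
    using subgroup.m_inv_closed[OF N] subgroup.m_inv_closed[OF D] subgroup.mem_carrier[OF N]
    by (auto simp: nat_pow_inv)
next
  fix v w assume vw: "v \<in> ?S" "w \<in> ?S"
  then have G: "v \<in> carrier G" "w \<in> carrier G" using subgroup.mem_carrier[OF N] by auto
  have "(v \<otimes> w) [^] n \<otimes> inv (v [^] n \<otimes> w [^] n) \<in> D"
    using hom[of v w] vw G coset_eq_iff[of "(v \<otimes> w) [^] n" "v [^] n \<otimes> w [^] n"] \<open>H \<subseteq> D\<close> by auto
  then have "(v \<otimes> w) [^] n \<otimes> inv (v [^] n \<otimes> w [^] n) \<otimes> (v [^] n \<otimes> w [^] n) \<in> D"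
    using vw by (simp add: subgroup.m_closed[OF D])
  then have "(v \<otimes> w) [^] n \<in> D" using G by (simp add: m_assoc)
  then show "v \<otimes> w \<in> ?S" using vw subgroup.m_closed[OF N] by blast
qed

lemma coset_eqD:
  assumes "x \<in> carrier G" "y \<in> carrier G" "H #> x = H #> y"
  obtains t where "t \<in> H" "x = t \<otimes> y"
proof
  show "x \<otimes> inv y \<in> H" using assms by (simp add: coset_eq_iff)
  show "x = x \<otimes> inv y \<otimes> y" using assms by (simp add: m_assoc)
qed

lemma in_if_coset_eq:
  assumes "H #> x = H #> y" "x \<in> carrier G" "y \<in> D" "subgroup D G" "H \<subseteq> D"
  shows "x \<in> D"
proof -
  have "y \<in> carrier G" using subgroup.mem_carrier[OF assms(4,3)] .
  then obtain t where "t \<in> H" "x = t \<otimes> y" using coset_eqD[OF assms(2) _ assms(1)] by blast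
  then show ?thesis using subgroup.m_closed[OF assms(4), of t y] assms(3,5) by auto
qed

end

context group
begin

lemma comm_subgroup_closed: "H \<subseteq> carrier G \<Longrightarrow> K \<subseteq> carrier G \<Longrightarrow> comm_subgroup G H K \<subseteq> carrier G"
  unfolding comm_subgroup_eq by (intro generate_incl) auto

lemma comm_subgroup_incl: "h \<in> H \<Longrightarrow> k \<in> K \<Longrightarrow> \<langle>h, k\<rangle> \<in> comm_subgroup G H K"
  unfolding comm_subgroup_eq by (intro generate.incl) blast

lemma comm_subgroup_least:
  assumes "subgroup T G" "\<And>h k. h \<in> H \<Longrightarrow> k \<in> K \<Longrightarrow> \<langle>h, k\<rangle> \<in> T"
  shows "comm_subgroup G H K \<subseteq> T"
  unfolding comm_subgroup_eq using assms by (intro generate_subgroup_incl) auto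

lemma comm_subgroup_mono:
  "H \<subseteq> H' \<Longrightarrow> K \<subseteq> K' \<Longrightarrow> comm_subgroup G H K \<subseteq> comm_subgroup G H' K'"
  unfolding comm_subgroup_eq by (intro mono_generate) blast

lemma comm_subgroup_normal:
  assumes "H \<lhd> G" "K \<lhd> G"
  shows "comm_subgroup G H K \<lhd> G"
  unfolding comm_subgroup_eq
proof (rule normal_generateI)
  have HK: "H \<subseteq> carrier G" "K \<subseteq> carrier G"
    using assms by (simp_all add: normal_imp_subgroup subgroup.subset)
  then show "{\<langle>h, k\<rangle> | h k. h \<in> H \<and> k \<in> K} \<subseteq> carrier G" by auto
  fix c g assume c: "c \<in> {\<langle>h, k\<rangle> | h k. h \<in> H \<and> k \<in> K}" and g: "g \<in> carrier G"
  then obtain h k where hk: "h \<in> H" "k \<in> K" "c = \<langle>h, k\<rangle>" by blast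
  then have "g \<otimes> c \<otimes> inv g = \<langle>g \<otimes> h \<otimes> inv g, g \<otimes> k \<otimes> inv g\<rangle>"
    using HK g by (auto intro!: commutator_conj)
  then show "g \<otimes> c \<otimes> inv g \<in> {\<langle>h, k\<rangle> | h k. h \<in> H \<and> k \<in> K}"
    using hk g assms normal_invE(2) by blast
qed

lemma comm_subgroup_subset: "H \<lhd> G \<Longrightarrow> comm_subgroup G H (carrier G) \<subseteq> H"
  by (intro comm_subgroup_least) (auto simp: normal_imp_subgroup intro: normal.commutator_in)

text \<open>Modulo \<open>[C, G]\<close> the elements of \<open>C\<close> are central, so they drop out of commutators.\<close>
lemma coset_commutator_mult_left:
  assumes C: "C \<lhd> G" and "t \<in> C" and a: "a \<in> carrier G" and y: "y \<in> carrier G"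
  shows "comm_subgroup G C (carrier G) #> \<langle>t \<otimes> a, y\<rangle> = comm_subgroup G C (carrier G) #> \<langle>a, y\<rangle>"
    (is "?T #> _ = _")
proof -
  interpret T: normal ?T G by (intro comm_subgroup_normal C normal_self)
  have t: "t \<in> carrier G" using assms by (meson normal_imp_subgroup subgroup.mem_carrier)
  have "\<langle>t, \<langle>a, y\<rangle>\<rangle> \<in> ?T" "\<langle>t, y\<rangle> \<in> ?T"
    using assms by (auto intro: comm_subgroup_incl)
  then have "\<langle>t, \<langle>a, y\<rangle>\<rangle> \<otimes> (\<langle>a, y\<rangle> \<otimes> \<langle>t, y\<rangle> \<otimes> inv \<langle>a, y\<rangle>) \<in> ?T"
    using a y by (intro T.m_closed T.inv_op_closed2) auto
  also have "\<langle>t, \<langle>a, y\<rangle>\<rangle> \<otimes> (\<langle>a, y\<rangle> \<otimes> \<langle>t, y\<rangle> \<otimes> inv \<langle>a, y\<rangle>) = \<langle>t \<otimes> a, y\<rangle> \<otimes> inv \<langle>a, y\<rangle>"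
    using t a y by (simp add: word_simps)
  finally show ?thesis using t a y by (simp add: T.coset_eq_iff)
qed

end

section \<open>Filtrations with additive p-th power maps\<close>

text \<open>The model is the series of \<open>p\<^sup>i\<close>-th powers in a powerful \<open>p\<close>-group, whose definition also treats
  \<open>p = 2\<close> separately. The two conditions on commutators are what kills the error term of
  \<open>coset_pow_prime\<close>, so that the \<open>p\<close>-th power map is a homomorphism from \<open>A\<^sub>i\<close> to \<open>A\<^sub>i\<^sub>+\<^sub>1/A\<^sub>i\<^sub>+\<^sub>2\<close>;
  in the extension \<open>p_filtration\<close> it is also onto.\<close>
locale power_filtration = group +
  fixes p :: nat and A :: "nat \<Rightarrow> 'a set"
  assumes prime: "Factorial_Ring.prime p"
    and normal_A: "A i \<lhd> G"
    and decreasing: "A (Suc i) \<subseteq> A i"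
    and commutator_in: "x \<in> A i \<Longrightarrow> g \<in> carrier G \<Longrightarrow> \<langle>x, g\<rangle> \<in> A (Suc i)"
    and commutator_in_if_two:
      "p = 2 \<Longrightarrow> x \<in> A i \<Longrightarrow> g \<in> carrier G \<Longrightarrow> \<langle>x, g\<rangle> \<in> A (Suc (Suc i))"
    and power_in: "x \<in> A i \<Longrightarrow> x [^] p \<in> A (Suc i)"
begin

lemma A_carrier: "x \<in> A i \<Longrightarrow> x \<in> carrier G"
  using normal_A by (meson normal_imp_subgroup subgroup.mem_carrier)

lemma power_additive:
  assumes x: "x \<in> A i" and y: "y \<in> A i"
  shows "A (Suc (Suc i)) #> (x \<otimes> y) [^] p = A (Suc (Suc i)) #> (x [^] p \<otimes> y [^] p)"
proof (rule normal.coset_pow_prime[OF normal_A prime])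
  have "\<langle>y, x\<rangle> \<in> A (Suc i)" using x y by (intro commutator_in A_carrier)
  then show "\<langle>\<langle>y, x\<rangle>, x\<rangle> \<in> A (Suc (Suc i))" "\<langle>\<langle>y, x\<rangle>, y\<rangle> \<in> A (Suc (Suc i))"
    "\<langle>y, x\<rangle> [^] p \<in> A (Suc (Suc i))"
    using x y commutator_in A_carrier power_in by blast+
  show "p = 2 \<Longrightarrow> \<langle>y, x\<rangle> \<in> A (Suc (Suc i))"
    using x y by (intro commutator_in_if_two A_carrier)
qed (use x y A_carrier in auto)

end

locale p_filtration = power_filtration +
  assumes power_surj:
      "x \<in> A (Suc i) \<Longrightarrow> \<exists>w\<in>A i. A (Suc (Suc i)) #> x = A (Suc (Suc i)) #> w [^] p"
begin

abbreviation "AG i \<equiv> comm_subgroup G (A i) (carrier G)"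

lemma AG_normal: "AG i \<lhd> G"
  by (intro comm_subgroup_normal normal_A normal_self)

lemma AG_subset: "AG i \<subseteq> A (Suc i)"
  using normal_imp_subgroup[OF normal_A] commutator_in by (intro comm_subgroup_least) auto

lemma AG_subset_if_two: "p = 2 \<Longrightarrow> AG i \<subseteq> A (Suc (Suc i))"
  using normal_imp_subgroup[OF normal_A] commutator_in_if_two by (intro comm_subgroup_least) auto

lemma AG_subset_A: "AG i \<subseteq> A i"
  using AG_subset decreasing by blast

lemma AG_decreasing: "AG (Suc i) \<subseteq> AG i"
  by (intro comm_subgroup_mono decreasing) simp

text \<open>Additivity holds here even modulo \<open>[A\<^sub>i\<^sub>+\<^sub>2, G]\<close>: for \<open>u \<in> [A\<^sub>i, G]\<close> the error \<open>[u, g]\<close> lies in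
  \<open>A\<^sub>i\<^sub>+\<^sub>2\<close> and is central modulo \<open>[A\<^sub>i\<^sub>+\<^sub>2, G]\<close>, whence \<open>[u, g]\<^sup>p = [u\<^sup>p, g]\<close>, and \<open>u\<^sup>p\<close> lies in \<open>A\<^sub>i\<^sub>+\<^sub>2\<close>.
  If \<open>p = 2\<close>, then \<open>u\<close> itself lies in \<open>A\<^sub>i\<^sub>+\<^sub>2\<close> and the error vanishes.\<close>
lemma AG_power_additive:
  assumes g: "g \<in> A i" and u: "u \<in> AG i"
  shows "AG (Suc (Suc i)) #> (g \<otimes> u) [^] p = AG (Suc (Suc i)) #> (g [^] p \<otimes> u [^] p)"
proof -
  let ?T = "AG (Suc (Suc i))"
  interpret T: normal ?T G by (rule AG_normal)
  have gG: "g \<in> carrier G" and uG: "u \<in> carrier G"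
    using g u AG_subset_A A_carrier by blast+
  have u1: "u \<in> A (Suc i)" using u AG_subset by blast
  have "\<langle>u, g\<rangle> \<in> A (Suc (Suc i))" using u1 gG by (rule commutator_in)
  then have c: "\<langle>\<langle>u, g\<rangle>, z\<rangle> \<in> ?T" if "z \<in> carrier G" for z
    using that by (rule comm_subgroup_incl)
  show ?thesis
  proof (rule T.coset_pow_prime[OF prime])
    have "\<langle>u [^] p, g\<rangle> \<in> ?T" using power_in[OF u1] gG by (rule comm_subgroup_incl)
    moreover have "\<langle>?T #> u, ?T #> g\<rangle>\<^bsub>G Mod ?T\<^esub> \<otimes>\<^bsub>G Mod ?T\<^esub> (?T #> u)
        = (?T #> u) \<otimes>\<^bsub>G Mod ?T\<^esub> \<langle>?T #> u, ?T #> g\<rangle>\<^bsub>G Mod ?T\<^esub>"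
      using T.coset_commute_iff[of "\<langle>u, g\<rangle>" u] c[OF uG] uG gG
      by (simp add: T.coset_commutator del: mult_FactGroup)
    then have "?T #> \<langle>u [^] p, g\<rangle> = ?T #> \<langle>u, g\<rangle> [^] p"
      using T.Q.H.commutator_pow_left[of "?T #> u" "?T #> g" p] uG gG
      by (simp add: T.coset_commutator T.Q.hom_nat_pow del: mult_FactGroup)
    ultimately show "\<langle>u, g\<rangle> [^] p \<in> ?T"
      using T.coset_eq_one_iff[of "\<langle>u [^] p, g\<rangle>"] T.coset_eq_one_iff[of "\<langle>u, g\<rangle> [^] p"] uG gG
      by simp
    assume "p = 2"
    then show "\<langle>u, g\<rangle> \<in> ?T" using AG_subset_if_two u gG by (intro comm_subgroup_incl) auto
  qed (use c uG gG in auto)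
qed

text \<open>The conjugate of \<open>x\<^sup>-\<^sup>1\<close> by \<open>y\<close> is \<open>x\<^sup>-\<^sup>1 [x, y]\<close>; take \<open>p\<close>-th powers of both and use additivity.\<close>
lemma AG_power_commutator:
  assumes x: "x \<in> A i" and y: "y \<in> carrier G"
  shows "AG (Suc (Suc i)) #> \<langle>x [^] p, y\<rangle> = AG (Suc (Suc i)) #> \<langle>x, y\<rangle> [^] p"
proof -
  let ?T = "AG (Suc (Suc i))" and ?v = "\<langle>x, y\<rangle>"
  interpret T: normal ?T G by (rule AG_normal)
  have xG: "x \<in> carrier G" using x A_carrier by blast
  have "?T #> (inv x \<otimes> ?v) [^] p = ?T #> ((inv x) [^] p \<otimes> ?v [^] p)"
    using x y by (intro AG_power_additive comm_subgroup_incl)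
      (auto simp: normal_A normal_imp_subgroup subgroup.m_inv_closed)
  also have "inv x \<otimes> ?v = y \<otimes> inv x \<otimes> inv y" using xG y by (simp add: word_simps)
  finally have "?T #> (y \<otimes> (inv x) [^] p \<otimes> inv y) = ?T #> ((inv x) [^] p \<otimes> ?v [^] p)"
    using xG y by (simp add: nat_pow_conj)
  then have "?T #> (x [^] p \<otimes> (y \<otimes> (inv x) [^] p \<otimes> inv y))
      = ?T #> (x [^] p \<otimes> ((inv x) [^] p \<otimes> ?v [^] p))"
    using xG y by simp
  moreover have "x [^] p \<otimes> (y \<otimes> (inv x) [^] p \<otimes> inv y) = \<langle>x [^] p, y\<rangle>"
    using xG y by (simp add: nat_pow_inv commutator_def m_assoc)
  moreover have "x [^] p \<otimes> ((inv x) [^] p \<otimes> ?v [^] p) = ?v [^] p"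
    using xG y by (simp add: nat_pow_inv)
  ultimately show ?thesis by simp
qed

text \<open>Since the power map is additive on \<open>[A\<^sub>i, G]\<close>, closure and surjectivity only have to be checked
  on the generators \<open>[x, y]\<close>, where \<open>[x, y]\<^sup>p = [x\<^sup>p, y]\<close> reduces them to the same properties of
  \<open>A\<^sub>i\<close>.\<close>
theorem p_filtration_comm_subgroup: "p_filtration G p (\<lambda>i. comm_subgroup G (A i) (carrier G))"
proof (intro p_filtration.intro p_filtration_axioms.intro
    power_filtration.intro power_filtration_axioms.intro is_group prime)
  fix i
  let ?T = "AG (Suc (Suc i))"
  interpret T: normal ?T G by (rule AG_normal)
  have hom: "?T #> (x \<otimes> y) [^] p = ?T #> (x [^] p \<otimes> y [^] p)" if "x \<in> AG i" "y \<in> AG i" for x y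
    using that AG_subset_A by (intro AG_power_additive) auto
  have pw: "\<langle>x, y\<rangle> [^] p \<in> AG (Suc i)" if x: "x \<in> A i" and y: "y \<in> carrier G" for x y
  proof (rule T.in_if_coset_eq)
    show "?T #> \<langle>x, y\<rangle> [^] p = ?T #> \<langle>x [^] p, y\<rangle>" using AG_power_commutator x y by simp
    show "\<langle>x [^] p, y\<rangle> \<in> AG (Suc i)" using x y power_in by (intro comm_subgroup_incl)
  qed (use x y A_carrier AG_normal AG_decreasing in \<open>auto simp: normal_imp_subgroup\<close>)
  show "AG i \<lhd> G" by (rule AG_normal)
  show "AG (Suc i) \<subseteq> AG i" by (rule AG_decreasing)
  {
    fix x g assume "x \<in> AG i" "g \<in> carrier G"
    then show "\<langle>x, g\<rangle> \<in> AG (Suc i)" using AG_subset by (intro comm_subgroup_incl) auto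
  next
    fix x g assume "p = 2" "x \<in> AG i" "g \<in> carrier G"
    then show "\<langle>x, g\<rangle> \<in> ?T" using AG_subset_if_two by (intro comm_subgroup_incl) auto
  next
    fix x assume x: "x \<in> AG i"
    have "AG i \<subseteq> {w \<in> AG i. w [^] p \<in> AG (Suc i)}"
    proof (rule comm_subgroup_least)
      show "subgroup {w \<in> AG i. w [^] p \<in> AG (Suc i)} G"
        using hom AG_normal AG_decreasing
        by (intro T.power_preimage_subgroup) (auto simp: normal_imp_subgroup)
    qed (use pw comm_subgroup_incl in auto)
    then show "x [^] p \<in> AG (Suc i)" using x by blast
  next
    fix x assume x: "x \<in> AG (Suc i)"
    have "AG (Suc i) \<subseteq> {x \<in> carrier G. \<exists>w\<in>AG i. ?T #> x = ?T #> w [^] p}"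
    proof (rule comm_subgroup_least)
      show "subgroup {x \<in> carrier G. \<exists>w\<in>AG i. ?T #> x = ?T #> w [^] p} G"
        using hom AG_normal by (intro T.powers_mod_subgroup) (auto simp: normal_imp_subgroup)
      fix b y assume b: "b \<in> A (Suc i)" and y: "y \<in> carrier G"
      obtain a where a: "a \<in> A i" "A (Suc (Suc i)) #> b = A (Suc (Suc i)) #> a [^] p"
        using power_surj[OF b] by blast
      have G: "a \<in> carrier G" "b \<in> carrier G" using a b A_carrier by blast+
      obtain t where t: "t \<in> A (Suc (Suc i))" "b = t \<otimes> a [^] p"
        using normal.coset_eqD[OF normal_A _ _ a(2)] G by blast
      have "?T #> \<langle>b, y\<rangle> = ?T #> \<langle>a, y\<rangle> [^] p"
        using coset_commutator_mult_left[OF normal_A t(1) _ y, of "a [^] p"] t(2) G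
          AG_power_commutator[OF a(1) y] by simp
      then show "\<langle>b, y\<rangle> \<in> {x \<in> carrier G. \<exists>w\<in>AG i. ?T #> x = ?T #> w [^] p}"
        using G y comm_subgroup_incl[OF a(1) y] by blast
    qed
    then show "\<exists>w\<in>AG i. ?T #> x = ?T #> w [^] p" using x by blast
  }
qed

end

lemma p_filtration_iter_comm:
  "p_filtration G p A \<Longrightarrow> p_filtration G p (\<lambda>i. iter_comm G (A i) k)"
  by (induction k) (auto dest: p_filtration.p_filtration_comm_subgroup)

context group_hom
begin

lemma normal_preimage:
  assumes "N \<lhd> H"
  shows "{x \<in> carrier G. h x \<in> N} \<lhd> G"
proof -
  interpret N: normal N H by fact
  show ?thesis
  proof (rule G.normal_invI[OF G.subgroupI])
    have "\<one> \<in> {x \<in> carrier G. h x \<in> N}" by simp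
    then show "{x \<in> carrier G. h x \<in> N} \<noteq> {}" by blast
  qed (auto intro: N.inv_op_closed2 subgroup.m_closed[OF N.subgroup_axioms]
         subgroup.m_inv_closed[OF N.subgroup_axioms])
qed

lemma hom_commutator:
  "x \<in> carrier G \<Longrightarrow> y \<in> carrier G \<Longrightarrow> h \<langle>x, y\<rangle> = \<langle>h x, h y\<rangle>\<^bsub>H\<^esub>"
  by (simp add: commutator_def)

text \<open>The filtration is found in the powerful group, but commutators have to be formed in the group
  that covers it; so the filtration is lifted.\<close>
lemma p_filtration_preimage:
  assumes "p_filtration H p A" and surj: "h ` carrier G = carrier H"
  shows "p_filtration G p (\<lambda>i. {x \<in> carrier G. h x \<in> A i})"
proof -
  interpret A: p_filtration H p A by fact
  let ?A = "\<lambda>i. {x \<in> carrier G. h x \<in> A i}"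
  have normal: "?A i \<lhd> G" for i by (intro normal_preimage A.normal_A)
  show ?thesis
  proof (intro p_filtration.intro p_filtration_axioms.intro power_filtration.intro
      power_filtration_axioms.intro G.is_group A.prime normal)
    fix i
    show "?A (Suc i) \<subseteq> ?A i" using A.decreasing by blast
    fix x
    show "\<exists>w\<in>?A i. ?A (Suc (Suc i)) #> x = ?A (Suc (Suc i)) #> w [^] p" if x: "x \<in> ?A (Suc i)"
    proof -
      obtain v where v: "v \<in> A i" "A (Suc (Suc i)) #>\<^bsub>H\<^esub> h x = A (Suc (Suc i)) #>\<^bsub>H\<^esub> v [^]\<^bsub>H\<^esub> p"
        using A.power_surj x by blast
      then have "v \<in> h ` carrier G" using surj A.A_carrier by simp
      then obtain w where w: "w \<in> carrier G" "v = h w" by blast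
      have "h x \<otimes>\<^bsub>H\<^esub> inv\<^bsub>H\<^esub> (v [^]\<^bsub>H\<^esub> p) \<in> A (Suc (Suc i))"
        by (rule normal.coset_eq_iff[OF A.normal_A, THEN iffD1]) (use v x w in auto)
      then have "x \<otimes> inv (w [^] p) \<in> ?A (Suc (Suc i))" using x w by (simp add: hom_nat_pow)
      then have "?A (Suc (Suc i)) #> x = ?A (Suc (Suc i)) #> w [^] p"
        by (intro normal.coset_eq_iff[OF normal, THEN iffD2]) (use x w in auto)
      then show ?thesis using w v by blast
    qed
  qed (auto simp: hom_commutator hom_nat_pow intro: A.commutator_in A.commutator_in_if_two A.power_in)
qed

end

context p_filtration
begin

lemma iterated_power_in: "x \<in> A 0 \<Longrightarrow> x [^] (p ^ i) \<in> A i"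
proof (induction i)
  case (Suc i)
  then show ?case
    using power_in[of "x [^] (p ^ i)" i] A_carrier[OF Suc.prems] by (simp add: nat_pow_pow mult.commute)
next
  case 0
  then show ?case using A_carrier[OF 0] by simp
qed

lemma power_cong:
  assumes x: "x \<in> A i" and y: "y \<in> A i" and eq: "A (Suc i) #> x = A (Suc i) #> y"
  shows "A (Suc (Suc i)) #> x [^] p = A (Suc (Suc i)) #> y [^] p"
proof -
  interpret T: normal "A (Suc (Suc i))" G by (rule normal_A)
  have G: "x \<in> carrier G" "y \<in> carrier G" using x y A_carrier by blast+
  obtain t where t: "t \<in> A (Suc i)" "x = t \<otimes> y"
    using normal.coset_eqD[OF normal_A G eq] by blast
  have "A (Suc (Suc i)) #> x [^] p = A (Suc (Suc i)) #> (t [^] p \<otimes> y [^] p)"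
    unfolding t(2) using t(1) decreasing y by (intro power_additive) auto
  also have "\<dots> = A (Suc (Suc i)) #> y [^] p"
  proof (subst T.coset_eq_iff)
    show "t [^] p \<otimes> y [^] p \<otimes> inv (y [^] p) \<in> A (Suc (Suc i))"
      using power_in[OF t(1)] A_carrier[OF t(1)] G by (simp add: m_assoc)
  qed (use G A_carrier[OF t(1)] in auto)
  finally show ?thesis .
qed

text \<open>The composite of the surjections \<open>A\<^sub>0/A\<^sub>1 \<rightarrow> A\<^sub>1/A\<^sub>2 \<rightarrow> \<dots> \<rightarrow> A\<^sub>i/A\<^sub>i\<^sub>+\<^sub>1\<close>.\<close>
lemma iterated_power_surj:
  assumes "x \<in> A i"
  shows "\<exists>y\<in>A 0. A (Suc i) #> x = A (Suc i) #> y [^] (p ^ i)"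
  using assms
proof (induction i arbitrary: x)
  case 0
  then show ?case using A_carrier[OF 0] by (intro bexI[of _ x]) simp_all
next
  case (Suc i)
  obtain w where w: "w \<in> A i" "A (Suc (Suc i)) #> x = A (Suc (Suc i)) #> w [^] p"
    using power_surj[OF Suc.prems] by blast
  obtain y where y: "y \<in> A 0" "A (Suc i) #> w = A (Suc i) #> y [^] (p ^ i)"
    using Suc.IH[OF w(1)] by blast
  have "A (Suc (Suc i)) #> w [^] p = A (Suc (Suc i)) #> (y [^] (p ^ i)) [^] p"
    by (intro power_cong w(1) y(2) iterated_power_in y(1))
  then show ?case using w(2) y(1) A_carrier[OF y(1)]
    by (intro bexI[of _ y]) (simp_all add: nat_pow_pow mult.commute)
qed

end

section \<open>Finite p-groups\<close>

text \<open>For a normal subgroup \<open>T\<close> this is the preimage of the centralizer of the image of \<open>A\<close> in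
  \<open>G/T\<close>.\<close>
definition centralizer_mod :: "('a, 'm) monoid_scheme \<Rightarrow> 'a set \<Rightarrow> 'a set \<Rightarrow> 'a set" where
  "centralizer_mod G A T = {x \<in> carrier G. \<forall>g\<in>A. \<langle>x, g\<rangle>\<^bsub>G\<^esub> \<in> T}"

abbreviation central_mod :: "('a, 'm) monoid_scheme \<Rightarrow> 'a set \<Rightarrow> 'a set" where
  "central_mod G \<equiv> centralizer_mod G (carrier G)"

context group
begin

lemma centralizer_mod_subgroup:
  assumes "T \<lhd> G" "A \<subseteq> carrier G"
  shows "subgroup (centralizer_mod G A T) G"
proof (rule subgroupI)
  interpret T: normal T G by fact
  have "\<one> \<in> centralizer_mod G A T"
    using assms(2) by (auto simp: centralizer_mod_def subset_iff)
  then show "centralizer_mod G A T \<noteq> {}" by blast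
  fix x assume x: "x \<in> centralizer_mod G A T"
  show "inv x \<in> centralizer_mod G A T"
    using x assms(2) T.inv_op_closed1[of x "inv \<langle>x, g\<rangle>" for g]
    by (auto simp: centralizer_mod_def commutator_inv_left subset_iff)
  fix y assume "y \<in> centralizer_mod G A T"
  then show "x \<otimes> y \<in> centralizer_mod G A T"
    using x assms(2)
    by (auto simp: centralizer_mod_def commutator_mult_left T.inv_op_closed2
        subgroup.m_closed[OF T.subgroup_axioms] subset_iff)
qed (auto simp: centralizer_mod_def)

lemma centralizer_mod_normal:
  assumes "T \<lhd> G" "A \<lhd> G"
  shows "centralizer_mod G A T \<lhd> G"
proof -
  interpret T: normal T G by fact
  interpret A: normal A G by fact
  show ?thesis
  proof (rule normal_invI[OF centralizer_mod_subgroup[OF assms(1) A.subset]])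
    fix x h assume x: "x \<in> carrier G" and h: "h \<in> centralizer_mod G A T"
    have "\<langle>x \<otimes> h \<otimes> inv x, g\<rangle> \<in> T" if g: "g \<in> A" for g
    proof -
      have "x \<otimes> \<langle>h, inv x \<otimes> g \<otimes> x\<rangle> \<otimes> inv x \<in> T"
        using h x A.inv_op_closed1[OF x g]
        by (intro T.inv_op_closed2) (auto simp: centralizer_mod_def)
      then show ?thesis using h x g A.mem_carrier[OF g] by (simp add: centralizer_mod_def word_simps)
    qed
    then show "x \<otimes> h \<otimes> inv x \<in> centralizer_mod G A T" using x h by (simp add: centralizer_mod_def)
  qed
qed

lemmas central_mod_normal = centralizer_mod_normal[OF _ normal_self]

lemma subset_central_mod: "T \<lhd> G \<Longrightarrow> T \<subseteq> central_mod G T"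
  using normal.commutator_in[of T G] normal_imp_subgroup subgroup.mem_carrier
  by (fastforce simp: centralizer_mod_def)

lemma comm_subgroup_subset_iff:
  assumes "T \<lhd> G" "H \<subseteq> carrier G"
  shows "comm_subgroup G H (carrier G) \<subseteq> T \<longleftrightarrow> H \<subseteq> central_mod G T"
proof
  assume "comm_subgroup G H (carrier G) \<subseteq> T"
  then show "H \<subseteq> central_mod G T"
    using assms comm_subgroup_incl by (fastforce simp: centralizer_mod_def)
next
  assume "H \<subseteq> central_mod G T"
  then show "comm_subgroup G H (carrier G) \<subseteq> T"
    using assms(1) by (intro comm_subgroup_least) (auto simp: centralizer_mod_def normal_imp_subgroup)
qed

text \<open>The class equation: every conjugacy class other than that of a central element has size
  divisible by \<open>p\<close>. If \<open>{\<one>}\<close> were the only class of size one, the order of the group would be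
  congruent to \<open>1\<close> modulo \<open>p\<close>.\<close>
lemma p_group_nontrivial_center:
  fixes p :: nat
  assumes p: "Factorial_Ring.prime p" and order: "order G = p ^ m" and nontrivial: "carrier G \<noteq> {\<one>}"
  shows "\<exists>z\<in>carrier G. z \<noteq> \<one> \<and> (\<forall>g\<in>carrier G. g \<otimes> z = z \<otimes> g)"
proof (rule ccontr)
  assume none: "\<not> ?thesis"
  let ?\<phi> = "\<lambda>g. \<lambda>h\<in>carrier G. g \<otimes> h \<otimes> inv g"
  interpret act: group_action G "carrier G" ?\<phi> by (rule action_by_conjugation)
  let ?O = "orbits G (carrier G) ?\<phi>"
  have "order G > 0" using order prime_gt_0_nat[OF p] by simp
  then have fin: "finite (carrier G)" by (simp add: order_gt_0_iff_finite)
  have orbit: "Group_Action.orbit G ?\<phi> x = {g \<otimes> x \<otimes> inv g | g. g \<in> carrier G}" if "x \<in> carrier G" for x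
    using that by (simp add: orbit_def)
  interpret part: partition "carrier G" ?O by (rule act.orbit_partition)
  have finO: "finite ?O" unfolding orbits_def using fin by simp
  have one: "{\<one>} \<in> ?O"
    using orbit[OF one_closed] by (auto simp: orbits_def intro!: exI[of _ \<one>])
  have dvd: "p dvd card A" if A: "A \<in> ?O" "A \<noteq> {\<one>}" for A
  proof -
    obtain x where x: "x \<in> carrier G" "A = Group_Action.orbit G ?\<phi> x"
      using A(1) unfolding orbits_def by blast
    have "card A * card (stabilizer G ?\<phi> x) = p ^ m"
      unfolding x(2) act.orbit_stabilizer_theorem[OF x(1)] by (rule order)
    then have "card A dvd p ^ m" by (intro dvdI) (rule sym)
    then obtain k where k: "card A = p ^ k" using p by (auto simp: divides_primepow_nat)
    have "k \<noteq> 0"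
    proof
      assume "k = 0"
      then obtain y where y: "A = {y}" using k by (auto simp: card_1_singleton_iff)
      have xA: "x \<in> A" using act.orbit_refl[OF x(1)] x(2) by simp
      have "g \<otimes> x \<otimes> inv g = x" if "g \<in> carrier G" for g
        using that xA y x orbit[OF x(1)] by blast
      then have "g \<otimes> x = x \<otimes> g" if "g \<in> carrier G" for g
        using that x(1) inv_solve_right[of x "g \<otimes> x" g] by simp
      then have "x = \<one>" using none x(1) by blast
      then show False using A(2) y xA by simp
    qed
    then show ?thesis using k by simp
  qed
  have "card (carrier G) = (\<Sum>A\<in>?O. card A)"
    using part.disjoint_sum[OF fin, of "\<lambda>_. 1 :: nat"] by simp
  also have "\<dots> = 1 + (\<Sum>A\<in>?O - {{\<one>}}. card A)"
    using finO one by (simp add: sum.remove)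
  finally have sum: "p ^ m = 1 + (\<Sum>A\<in>?O - {{\<one>}}. card A)" using order by (simp add: order_def)
  have "p dvd (\<Sum>A\<in>?O - {{\<one>}}. card A)" using dvd by (intro dvd_sum) auto
  moreover have "p dvd p ^ m"
  proof -
    have "m \<noteq> 0"
    proof
      assume "m = 0"
      then have "card (carrier G) = 1" using order by (simp add: order_def)
      then show False using nontrivial one_closed by (metis card_1_singletonE singletonD)
    qed
    then show ?thesis by simp
  qed
  ultimately have "p dvd 1"
    unfolding sum using dvd_add_left_iff[of p "\<Sum>A\<in>?O - {{\<one>}}. card A" 1] by blast
  then show False using p by simp
qed

end

context
  fixes p and G (structure)
  assumes p: "Factorial_Ring.prime p" and pG: "finite_p_group p G"
begin

interpretation group G using pG by (simp add: finite_p_group_def)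

lemma finite_p_group_carrier: "finite (carrier G)"
  using pG by (simp add: finite_p_group_def)

text \<open>The quotient \<open>G/T\<close> is a nontrivial \<open>p\<close>-group, and \<open>central_mod G T\<close> is the preimage of its
  center.\<close>
lemma central_mod_grows:
  assumes "T \<lhd> G" "T \<noteq> carrier G"
  shows "T \<subset> central_mod G T"
proof -
  interpret T: normal T G by fact
  obtain k where "order G = p ^ k" using pG by (auto simp: finite_p_group_def)
  then have "card (rcosets T) dvd p ^ k"
    using lagrange[OF T.subgroup_axioms] by (metis dvd_triv_left)
  then obtain m where "order (G Mod T) = p ^ m"
    using p by (auto simp: divides_primepow_nat order_def FactGroup_def)
  moreover have "carrier (G Mod T) \<noteq> {\<one>\<^bsub>G Mod T\<^esub>}"
  proof
    assume "carrier (G Mod T) = {\<one>\<^bsub>G Mod T\<^esub>}"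
    then have "T #> x = T" if "x \<in> carrier G" for x using that T.Q.hom_closed[of x] by simp
    then have "carrier G \<subseteq> T" using T.coset_eq_one_iff by blast
    then show False using assms T.subset by blast
  qed
  ultimately obtain Z where Z: "Z \<in> carrier (G Mod T)" "Z \<noteq> \<one>\<^bsub>G Mod T\<^esub>"
    "\<forall>K\<in>carrier (G Mod T). K \<otimes>\<^bsub>G Mod T\<^esub> Z = Z \<otimes>\<^bsub>G Mod T\<^esub> K"
    using T.Q.H.p_group_nontrivial_center[OF p] by blast
  then obtain z where z: "z \<in> carrier G" "Z = T #> z" by (auto simp: carrier_FactGroup)
  then have "\<langle>z, g\<rangle> \<in> T" if "g \<in> carrier G" for g
    using that Z(3) T.coset_commute_iff[of z g] T.Q.hom_closed[of g] by metis
  moreover have "z \<notin> T" using z Z(2) T.coset_eq_one_iff by auto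
  ultimately have "z \<in> central_mod G T - T" using z by (simp add: centralizer_mod_def)
  then show ?thesis using subset_central_mod[OF assms(1)] by blast
qed

lemma upper_central_series_exhausts:
  assumes C: "C \<lhd> G"
  shows "\<exists>j. (central_mod G ^^ j) C = carrier G"
proof (rule ccontr)
  assume none: "\<nexists>j. (central_mod G ^^ j) C = carrier G"
  let ?U = "\<lambda>j. (central_mod G ^^ j) C"
  have normal: "?U j \<lhd> G" for j by (induction j) (use C central_mod_normal in auto)
  have "j \<le> card (?U j)" for j
  proof (induction j)
    case (Suc j)
    have "?U j \<subset> ?U (Suc j)" using central_mod_grows[OF normal] none by auto
    moreover have "finite (?U (Suc j))"
      using normal[of "Suc j"] finite_p_group_carrier by (meson finite_subset normal_imp_subgroup subgroup.subset)
    ultimately have "card (?U j) < card (?U (Suc j))" by (rule psubset_card_mono[rotated])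
    then show ?case using Suc by simp
  qed simp
  moreover have "card (?U j) \<le> card (carrier G)" for j
    using normal[of j] finite_p_group_carrier by (meson card_mono normal_imp_subgroup subgroup.subset)
  ultimately show False by (metis Suc_n_not_le_n le_trans)
qed

text \<open>A form of Nakayama's lemma for the nilpotent group \<open>G\<close>: to prove \<open>D \<subseteq> C\<close> one may calculate
  modulo \<open>[D, G]\<close>. The proof descends along the upper central series above \<open>C\<close>. If \<open>D\<close> lies in
  the term \<open>j + 1\<close>, then \<open>[D, G]\<close> lies in the term \<open>j\<close>, and by hypothesis so does \<open>D\<close>.\<close>
lemma subset_if_subset_mod_commutators:
  assumes C: "C \<lhd> G" and D: "D \<subseteq> carrier G"
    and mod: "\<And>T. T \<lhd> G \<Longrightarrow> C \<subseteq> T \<Longrightarrow> comm_subgroup G D (carrier G) \<subseteq> T \<Longrightarrow> D \<subseteq> T"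
  shows "D \<subseteq> C"
proof -
  let ?U = "\<lambda>j. (central_mod G ^^ j) C"
  have normal: "?U j \<lhd> G" for j by (induction j) (use C central_mod_normal in auto)
  have "C \<subseteq> ?U j" for j by (induction j) (use normal subset_central_mod in fastforce)+
  then have "D \<subseteq> ?U j" if "D \<subseteq> ?U (Suc j)" for j
    using that mod[OF normal] comm_subgroup_subset_iff[OF normal D] by simp
  then have "D \<subseteq> ?U j \<Longrightarrow> D \<subseteq> ?U 0" for j by (induction j) (auto simp del: funpow.simps)
  moreover obtain j where "?U j = carrier G" using upper_central_series_exhausts[OF C] by blast
  ultimately show ?thesis using D by (metis funpow_0)
qed

end

section \<open>The p-power series of a powerful p-group\<close>

primrec power_series :: "nat \<Rightarrow> ('a, 'm) monoid_scheme \<Rightarrow> nat \<Rightarrow> 'a set" where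
  "power_series p G 0 = carrier G"
| "power_series p G (Suc i) = generate G {x [^]\<^bsub>G\<^esub> p | x. x \<in> power_series p G i}"

declare power_series.simps(2) [simp del]

context group
begin

lemma power_series_normal: "power_series p G i \<lhd> G"
proof (induction i)
  case (Suc i)
  then interpret N: normal "power_series p G i" G .
  show ?case unfolding power_series.simps
  proof (rule normal_generateI)
    fix h g assume "h \<in> {x [^] p | x. x \<in> power_series p G i}" and g: "g \<in> carrier G"
    then obtain x where x: "x \<in> power_series p G i" "h = x [^] p" by blast
    then have "g \<otimes> h \<otimes> inv g = (g \<otimes> x \<otimes> inv g) [^] p" using g by (simp add: nat_pow_conj)
    then show "g \<otimes> h \<otimes> inv g \<in> {x [^] p | x. x \<in> power_series p G i}"
      using x g N.inv_op_closed2 by blast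
  qed auto
qed (simp add: normal_self)

lemma power_series_closed: "x \<in> power_series p G i \<Longrightarrow> x \<in> carrier G"
  using power_series_normal by (meson normal_imp_subgroup subgroup.mem_carrier)

lemma power_in_power_series: "x \<in> power_series p G i \<Longrightarrow> x [^] p \<in> power_series p G (Suc i)"
  by (auto simp: power_series.simps(2) intro: generate.incl)

lemma power_series_decreasing: "power_series p G (Suc i) \<subseteq> power_series p G i"
proof -
  interpret N: normal "power_series p G i" G by (rule power_series_normal)
  show ?thesis
    unfolding power_series.simps
    by (intro generate_subgroup_incl N.subgroup_axioms) (auto intro: N.nat_pow_in)
qed

lemma power_series_Suc_subset:
  assumes "T \<lhd> G" "\<And>x. x \<in> power_series p G i \<Longrightarrow> x [^] p \<in> T"
  shows "power_series p G (Suc i) \<subseteq> T"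
proof -
  have "{x [^] p | x. x \<in> power_series p G i} \<subseteq> T" using assms(2) by blast
  then show ?thesis
    unfolding power_series.simps(2) using normal_imp_subgroup[OF assms(1)] by (rule generate_subgroup_incl)
qed

text \<open>The conjugate of \<open>x\<close> by \<open>g\<close> is \<open>x v\<close>. If the power map is additive on this product and \<open>v\<^sup>p\<close>
  vanishes modulo \<open>T\<close>, then \<open>x\<^sup>p\<close> agrees with its conjugate modulo \<open>T\<close>.\<close>
lemma commutator_pow_in:
  fixes p :: nat
  assumes T: "T \<lhd> G" and p: "Factorial_Ring.prime p" and x: "x \<in> carrier G" and g: "g \<in> carrier G"
    and v: "v = \<langle>inv x, g\<rangle>" "v [^] p \<in> T"
    and c: "\<langle>\<langle>v, x\<rangle>, x\<rangle> \<in> T" "\<langle>\<langle>v, x\<rangle>, v\<rangle> \<in> T" "\<langle>v, x\<rangle> [^] p \<in> T" "p = 2 \<Longrightarrow> \<langle>v, x\<rangle> \<in> T"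
  shows "\<langle>x [^] p, g\<rangle> \<in> T"
proof -
  interpret T: normal T G by fact
  have vG: "v \<in> carrier G" using x g v by simp
  have "x \<otimes> v = g \<otimes> x \<otimes> inv g" using x g unfolding v(1) by (simp add: word_simps)
  then have "T #> (g \<otimes> x [^] p \<otimes> inv g) = T #> (x \<otimes> v) [^] p" using x g by (simp add: nat_pow_conj)
  also have "\<dots> = T #> (x [^] p \<otimes> v [^] p)"
    using c by (intro T.coset_pow_prime p x vG)
  also have "\<dots> = T #> x [^] p"
  proof (subst T.coset_eq_iff)
    show "x [^] p \<otimes> v [^] p \<otimes> inv (x [^] p) \<in> T" using x v(2) by (intro T.inv_op_closed2) auto
  qed (use x vG in auto)
  finally have "T #> x [^] p = T #> (g \<otimes> x [^] p \<otimes> inv g)" by (rule sym)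
  then have "x [^] p \<otimes> inv (g \<otimes> x [^] p \<otimes> inv g) \<in> T"
    by (rule T.coset_eq_iff[THEN iffD1, rotated 2]) (use x g in auto)
  then show ?thesis using x g by (simp add: word_simps)
qed

end

context
  fixes p and G (structure)
  assumes p: "Factorial_Ring.prime p" and pG: "finite_p_group p G"
begin

interpretation group G using pG by (simp add: finite_p_group_def)

text \<open>This is the fact that the \<open>p\<close>-th power of a powerfully embedded subgroup is powerfully
  embedded. By Nakayama's lemma one may calculate modulo \<open>[[G\<^sub>i\<^sub>+\<^sub>1, G], G]\<close>, where the commutators
  \<open>[v, x]\<close> with \<open>v \<in> G\<^sub>i\<^sub>+\<^sub>1\<close> are central.\<close>
lemma power_series_commutator_odd:
  assumes "p \<noteq> 2" and step: "power_series p G i \<subseteq> central_mod G (power_series p G (Suc i))"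
  shows "power_series p G (Suc i) \<subseteq> central_mod G (power_series p G (Suc (Suc i)))"
proof -
  let ?D = "comm_subgroup G (power_series p G (Suc i)) (carrier G)"
  have closed: "power_series p G i \<subseteq> carrier G" for i using power_series_closed by blast
  have "?D \<subseteq> power_series p G (Suc (Suc i))"
  proof (rule subset_if_subset_mod_commutators[OF p pG])
    fix T assume T: "T \<lhd> G" "power_series p G (Suc (Suc i)) \<subseteq> T" "comm_subgroup G ?D (carrier G) \<subseteq> T"
    interpret T: normal T G by fact
    have "power_series p G (Suc i) \<subseteq> central_mod G T"
    proof (rule power_series_Suc_subset[OF central_mod_normal[OF T(1)]])
      fix x assume x: "x \<in> power_series p G i"
      have xG: "x \<in> carrier G" using x closed by blast
      have "\<langle>x [^] p, g\<rangle> \<in> T" if g: "g \<in> carrier G" for g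
      proof (rule commutator_pow_in[OF T(1) p xG g refl])
        let ?v = "\<langle>inv x, g\<rangle>"
        have "inv x \<in> power_series p G i"
          using x power_series_normal by (meson normal_imp_subgroup subgroup.m_inv_closed)
        then have v: "?v \<in> power_series p G (Suc i)" using step g by (auto simp: centralizer_mod_def)
        then show "?v [^] p \<in> T" using power_in_power_series[of ?v p "Suc i"] T(2) by blast
        have c: "\<langle>?v, x\<rangle> \<in> ?D" using v xG by (rule comm_subgroup_incl)
        then show "\<langle>\<langle>?v, x\<rangle>, x\<rangle> \<in> T" "\<langle>\<langle>?v, x\<rangle>, ?v\<rangle> \<in> T"
          using xG g by (auto intro!: subsetD[OF T(3)] comm_subgroup_incl)
        have "\<langle>?v, x\<rangle> \<in> power_series p G (Suc i)" 
          using subsetD[OF comm_subgroup_subset[OF power_series_normal] c] .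
        then show "\<langle>?v, x\<rangle> [^] p \<in> T"
          using power_in_power_series[of "\<langle>?v, x\<rangle>" p "Suc i"] T(2) by blast
      qed (use \<open>p \<noteq> 2\<close> in simp)
      then show "x [^] p \<in> central_mod G T" using xG by (simp add: centralizer_mod_def)
    qed
    then show "?D \<subseteq> T" using comm_subgroup_subset_iff[OF T(1) closed] by simp
  qed (use comm_subgroup_closed[OF closed order_refl] power_series_normal in auto)
  then show ?thesis using comm_subgroup_subset_iff[OF power_series_normal closed] by simp
qed

text \<open>For \<open>p = 2\<close> the error term \<open>[v, x]\<close> itself has to vanish modulo \<open>T\<close>. Since \<open>v \<in> G\<^sub>i\<^sub>+\<^sub>2\<close> by
  hypothesis, this follows once the squares of elements of \<open>G\<^sub>i\<^sub>+\<^sub>1\<close> are known to be central modulo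
  \<open>T\<close>; so the same argument is run twice.\<close>
lemma power_series_commutator_two:
  assumes "p = 2" and step: "power_series p G i \<subseteq> central_mod G (power_series p G (Suc (Suc i)))"
  shows "power_series p G (Suc i) \<subseteq> central_mod G (power_series p G (Suc (Suc (Suc i))))"
proof -
  let ?D = "comm_subgroup G (power_series p G (Suc i)) (carrier G)"
  have closed: "power_series p G i \<subseteq> carrier G" for i using power_series_closed by blast
  have inv: "inv x \<in> power_series p G i" if "x \<in> power_series p G i" for x i
    using that power_series_normal by (meson normal_imp_subgroup subgroup.m_inv_closed)
  have "?D \<subseteq> power_series p G (Suc (Suc (Suc i)))"
  proof (rule subset_if_subset_mod_commutators[OF p pG])
    fix T assume T: "T \<lhd> G" "power_series p G (Suc (Suc (Suc i))) \<subseteq> T" "comm_subgroup G ?D (carrier G) \<subseteq> T"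
    interpret T: normal T G by fact
    have central: "power_series p G (Suc j) \<subseteq> central_mod G T"
      if *: "\<And>x g. x \<in> power_series p G j \<Longrightarrow> g \<in> carrier G \<Longrightarrow>
               \<langle>inv x, g\<rangle> \<in> power_series p G (Suc (Suc i)) \<and> \<langle>\<langle>inv x, g\<rangle>, x\<rangle> \<in> T" for j
    proof (rule power_series_Suc_subset[OF central_mod_normal[OF T(1)]])
      fix x assume x: "x \<in> power_series p G j"
      have xG: "x \<in> carrier G" using x closed by blast
      have "\<langle>x [^] p, g\<rangle> \<in> T" if g: "g \<in> carrier G" for g
      proof (rule commutator_pow_in[OF T(1) p xG g refl])
        show "\<langle>inv x, g\<rangle> [^] p \<in> T" 
          using *[OF x g] power_in_power_series[of "\<langle>inv x, g\<rangle>" p "Suc (Suc i)"] T(2) by blast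
      qed (use *[OF x g] xG g in \<open>auto intro: T.nat_pow_in\<close>)
      then show "x [^] p \<in> central_mod G T" using xG by (simp add: centralizer_mod_def)
    qed
    have v: "\<langle>inv x, g\<rangle> \<in> power_series p G (Suc (Suc i))" if "x \<in> power_series p G i" "g \<in> carrier G" for x g
      using that inv step by (auto simp: centralizer_mod_def)
    have sub: "power_series p G (Suc (Suc i)) \<subseteq> central_mod G T"
    proof (rule central)
      fix x g assume x: "x \<in> power_series p G (Suc i)" and g: "g \<in> carrier G"
      have "\<langle>inv x, g\<rangle> \<in> ?D" using inv[OF x] g by (rule comm_subgroup_incl)
      then show "\<langle>inv x, g\<rangle> \<in> power_series p G (Suc (Suc i)) \<and> \<langle>\<langle>inv x, g\<rangle>, x\<rangle> \<in> T"
        using v[of x g] power_series_decreasing x g T(3) closed comm_subgroup_incl by blast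
    qed
    have "power_series p G (Suc i) \<subseteq> central_mod G T"
    proof (rule central)
      fix x g assume x: "x \<in> power_series p G i" and g: "g \<in> carrier G"
      then show "\<langle>inv x, g\<rangle> \<in> power_series p G (Suc (Suc i)) \<and> \<langle>\<langle>inv x, g\<rangle>, x\<rangle> \<in> T"
        using v[OF x g] sub closed by (auto simp: centralizer_mod_def)
    qed
    then show "?D \<subseteq> T" using comm_subgroup_subset_iff[OF T(1) closed] by simp
  qed (use comm_subgroup_closed[OF closed order_refl] power_series_normal in auto)
  then show ?thesis using comm_subgroup_subset_iff[OF power_series_normal closed] by simp
qed

lemma powerful_power_series:
  assumes "powerful p G"
  shows "power_series p G i \<subseteq> central_mod G (power_series p G (Suc i))" "p = 2 \<Longrightarrow> power_series p G i \<subseteq> central_mod G (power_series p G (Suc (Suc i)))"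
proof -
  have derived: "carrier G \<subseteq> central_mod G N" if "derived G (carrier G) \<subseteq> N" for N
  proof
    fix x assume x: "x \<in> carrier G"
    have "\<langle>x, g\<rangle> \<in> derived G (carrier G)" if "g \<in> carrier G" for g
      unfolding derived_def commutator_def using x that by (intro generate.incl) blast
    then show "x \<in> central_mod G N" using x that by (auto simp: centralizer_mod_def)
  qed
  have odd: "power_series p G i \<subseteq> central_mod G (power_series p G (Suc i))" if "p \<noteq> 2"
  proof (induction i)
    case 0
    have "derived G (carrier G) \<subseteq> power_series p G 1"
      using assms that by (auto simp: powerful_def agemo_def power_series.simps(2))
    then show ?case using derived by simp
  qed (use that power_series_commutator_odd in blast)
  show two: "power_series p G i \<subseteq> central_mod G (power_series p G (Suc (Suc i)))" if "p = 2" for i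
  proof (induction i)
    case 0
    have "agemo p 2 G \<subseteq> power_series p G (Suc (Suc 0))"
      unfolding agemo_def
    proof (rule generate_subgroup_incl[OF _ normal_imp_subgroup[OF power_series_normal]])
      have "x [^] (p ^ 2) = (x [^] p) [^] p" if "x \<in> carrier G" for x
        using that by (simp add: nat_pow_pow power2_eq_square)
      then show "{x [^] (p ^ 2) | x. x \<in> carrier G} \<subseteq> power_series p G (Suc (Suc 0))"
        using power_in_power_series[of _ p] by (auto)
    qed
    then have "derived G (carrier G) \<subseteq> power_series p G (Suc (Suc 0))"
      using assms that by (auto simp: powerful_def)
    then show ?case using derived by simp
  qed (use that power_series_commutator_two in blast)
  show "power_series p G i \<subseteq> central_mod G (power_series p G (Suc i))"
    using odd two power_series_decreasing[of p "Suc i"] by (cases "p = 2") (auto simp: centralizer_mod_def)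
qed

lemma powerful_p_filtration:
  assumes "powerful p G"
  shows "p_filtration G p (power_series p G)"
proof -
  have filtration: "power_filtration G p (power_series p G)"
  proof (intro power_filtration.intro power_filtration_axioms.intro is_group p
      power_series_normal power_series_decreasing power_in_power_series)
    fix x i g assume *: "x \<in> power_series p G i" "g \<in> carrier G"
    then show "\<langle>x, g\<rangle> \<in> power_series p G (Suc i)"
      using powerful_power_series(1)[OF assms, of i] by (auto simp: centralizer_mod_def)
    assume "p = 2"
    then show "\<langle>x, g\<rangle> \<in> power_series p G (Suc (Suc i))"
      using * powerful_power_series(2)[OF assms, of i] unfolding centralizer_mod_def by blast
  qed
  interpret power_filtration G p "power_series p G" by (rule filtration)
  have "p_filtration_axioms G p (power_series p G)"
  proof
    fix x i assume x: "x \<in> power_series p G (Suc i)"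
    interpret T: normal "power_series p G (Suc (Suc i))" G by (rule power_series_normal)
    let ?S = "{x \<in> carrier G. \<exists>w\<in>power_series p G i. power_series p G (Suc (Suc i)) #> x = power_series p G (Suc (Suc i)) #> w [^] p}"
    have "subgroup ?S G"
      using power_additive by (intro T.powers_mod_subgroup normal_imp_subgroup[OF power_series_normal])
    then have "power_series p G (Suc i) \<subseteq> ?S"
      unfolding power_series.simps(2)[of p G i] using power_series_closed
      by (intro generate_subgroup_incl) (auto)
    then show "\<exists>w\<in>power_series p G i. power_series p G (Suc (Suc i)) #> x = power_series p G (Suc (Suc i)) #> w [^] p" using x by blast
  qed
  then show ?thesis using filtration by (intro p_filtration.intro)
qed

end

text \<open>As \<open>p\<^sup>e\<close>-th powers vanish, \<open>iterated_power_surj\<close> gives \<open>G\<^sub>e = G\<^sub>e\<^sub>+\<^sub>1\<close>. Thus \<open>G\<^sub>e\<close> is generated by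
  \<open>p\<close>-th powers of its own elements, and modulo \<open>[G\<^sub>e, G]\<close>, where the power map on \<open>G\<^sub>e\<close> is additive,
  each of its elements is a \<open>p\<close>-th power, hence a \<open>p\<^sup>e\<close>-th power, hence trivial. Nakayama's lemma
  concludes.\<close>
lemma (in group) power_series_trivial:
  assumes p: "Factorial_Ring.prime p" and pG: "finite_p_group p G" and "powerful p G"
    and exponent: "\<And>x. x \<in> carrier G \<Longrightarrow> x [^] (p ^ e) = \<one>"
  shows "power_series p G e = {\<one>}"
proof -
  let ?D = "power_series p G e"
  interpret p_filtration G p "power_series p G"
    by (rule powerful_p_filtration[OF p pG assms(3)])
  interpret D: normal ?D G by (rule normal_A)
  have stable: "?D \<subseteq> power_series p G (Suc e)"
  proof
    fix x assume x: "x \<in> ?D"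
    then obtain y where y: "y \<in> carrier G"
      "power_series p G (Suc e) #> x = power_series p G (Suc e) #> y [^] (p ^ e)"
      using iterated_power_surj[OF x] by auto
    interpret T: normal "power_series p G (Suc e)" G by (rule normal_A)
    show "x \<in> power_series p G (Suc e)"
      using y x exponent T.coset_eq_one_iff[of x] by (simp add: coset_mult_one T.subset)
  qed
  have "?D \<subseteq> {\<one>}"
  proof (rule subset_if_subset_mod_commutators[OF p pG one_is_normal D.subset])
    fix T assume T: "T \<lhd> G" "comm_subgroup G ?D (carrier G) \<subseteq> T"
    interpret T: normal T G by fact
    let ?pow = "\<lambda>n::nat. {x \<in> carrier G. \<exists>w\<in>?D. T #> x = T #> w [^] n}"
    have comm: "\<langle>x, y\<rangle> \<in> T" if "x \<in> ?D" "y \<in> carrier G" for x y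
      using that T(2) comm_subgroup_incl by blast
    have "subgroup (?pow p) G"
    proof (rule T.powers_mod_subgroup[OF D.subgroup_axioms])
      fix x y assume "x \<in> ?D" "y \<in> ?D"
      then show "T #> (x \<otimes> y) [^] p = T #> (x [^] p \<otimes> y [^] p)"
        using comm by (intro T.coset_pow_prime p) (auto intro: T.nat_pow_in)
    qed
    then have "power_series p G (Suc e) \<subseteq> ?pow p"
      unfolding power_series.simps(2) by (intro generate_subgroup_incl) auto
    then have step: "?D \<subseteq> ?pow p" using stable by blast
    have "?D \<subseteq> ?pow (p ^ k)" for k
    proof (induction k)
      case (Suc k)
      show ?case
      proof
        fix x assume x: "x \<in> ?D"
        then obtain w where w: "w \<in> ?D" "T #> x = T #> w [^] (p ^ k)" using Suc by blast
        then obtain v where v: "v \<in> ?D" "T #> w = T #> v [^] p" using step by blast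
        have "T #> w [^] (p ^ k) = T #> v [^] (p ^ Suc k)"
          using v w T.Q.hom_nat_pow[of w "p ^ k"] T.Q.hom_nat_pow[of "v [^] p" "p ^ k"]
          by (simp add: nat_pow_pow)
        then show "x \<in> ?pow (p ^ Suc k)" using x w v by auto
      qed
    qed auto
    then have "?D \<subseteq> ?pow (p ^ e)" .
    then show "?D \<subseteq> T" using exponent T.coset_eq_one_iff by (auto simp: coset_mult_one T.subset)
  qed
  then show ?thesis using D.one_closed by blast
qed

section \<open>Counting cosets\<close>

text \<open>For subgroups \<open>B \<subseteq> A\<close> this bounds the index of \<open>B\<close> in \<open>A\<close>. Finiteness is demanded explicitly
  because an infinite set has cardinality \<open>0\<close>.\<close>
definition index_le :: "('a, 'm) monoid_scheme \<Rightarrow> 'a set \<Rightarrow> 'a set \<Rightarrow> nat \<Rightarrow> bool" where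
  "index_le G A B n \<longleftrightarrow> finite ((#>\<^bsub>G\<^esub>) B ` A) \<and> card ((#>\<^bsub>G\<^esub>) B ` A) \<le> n"

lemma index_leI:
  assumes "finite T" "card T \<le> n" "\<And>x. x \<in> A \<Longrightarrow> \<exists>t\<in>T. B #>\<^bsub>G\<^esub> x = B #>\<^bsub>G\<^esub> t"
  shows "index_le G A B n"
proof -
  have "(#>\<^bsub>G\<^esub>) B ` A \<subseteq> (#>\<^bsub>G\<^esub>) B ` T" using assms(3) by blast
  moreover have "card ((#>\<^bsub>G\<^esub>) B ` T) \<le> n" using card_image_le[OF assms(1)] assms(2) le_trans by blast
  ultimately show ?thesis
    unfolding index_le_def using assms(1) by (meson card_mono finite_imageI finite_subset le_trans)
qed

lemma index_leE:
  assumes "index_le G A B n"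
  obtains T where "finite T" "card T \<le> n" "T \<subseteq> A" "\<And>x. x \<in> A \<Longrightarrow> \<exists>t\<in>T. B #>\<^bsub>G\<^esub> x = B #>\<^bsub>G\<^esub> t"
proof -
  obtain T where T: "T \<subseteq> A" "inj_on ((#>\<^bsub>G\<^esub>) B) T" "(#>\<^bsub>G\<^esub>) B ` A = (#>\<^bsub>G\<^esub>) B ` T"
    using subset_image_inj[of "(#>\<^bsub>G\<^esub>) B ` A" "(#>\<^bsub>G\<^esub>) B" A] by auto
  show ?thesis
  proof (rule that)
    show "finite T" "card T \<le> n"
      using assms T(2,3) by (auto simp: index_le_def card_image dest: finite_imageD)
    show "\<exists>t\<in>T. B #>\<^bsub>G\<^esub> x = B #>\<^bsub>G\<^esub> t" if "x \<in> A" for x using that T(3) by blast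
  qed (rule T(1))
qed

lemma index_le_mono:
  assumes "index_le G A B m" "A' \<subseteq> A" "m \<le> n"
  shows "index_le G A' B n"
proof -
  have sub: "(#>\<^bsub>G\<^esub>) B ` A' \<subseteq> (#>\<^bsub>G\<^esub>) B ` A" using assms(2) by (rule image_mono)
  moreover have fin: "finite ((#>\<^bsub>G\<^esub>) B ` A)" using assms(1) by (simp add: index_le_def)
  ultimately have "card ((#>\<^bsub>G\<^esub>) B ` A') \<le> card ((#>\<^bsub>G\<^esub>) B ` A)" by (intro card_mono)
  then show ?thesis
    using finite_subset[OF sub fin] assms(1,3) by (simp add: index_le_def)
qed

lemma (in group) index_le_trans:
  assumes B: "B \<lhd> G" and C: "C \<lhd> G" and A: "A \<subseteq> carrier G"
    and "index_le G A B m" "index_le G B C n"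
  shows "index_le G A C (m * n)"
proof -
  interpret B: normal B G by fact
  interpret C: normal C G by fact
  obtain S where S: "finite S" "card S \<le> m" "S \<subseteq> A" "\<And>x. x \<in> A \<Longrightarrow> \<exists>t\<in>S. B #> x = B #> t"
    by (rule index_leE[OF assms(4)], rule that)
  obtain T where T: "finite T" "card T \<le> n" "T \<subseteq> B" "\<And>x. x \<in> B \<Longrightarrow> \<exists>t\<in>T. C #> x = C #> t"
    by (rule index_leE[OF assms(5)], rule that)
  show ?thesis
  proof (rule index_leI)
    let ?U = "(\<lambda>(s, t). t \<otimes> s) ` (S \<times> T)"
    show "finite ?U" using S T by simp
    have "card ?U \<le> card S * card T"
      using card_image_le[of "S \<times> T" "\<lambda>(s, t). t \<otimes> s"] S T by (simp add: card_cartesian_product)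
    also have "\<dots> \<le> m * n" using S T by (intro mult_mono) auto
    finally show "card ?U \<le> m * n" .
    fix x assume x: "x \<in> A"
    then obtain s where s: "s \<in> S" "B #> x = B #> s" using S by blast
    have G: "x \<in> carrier G" "s \<in> carrier G" using x s S A by blast+
    obtain b where b: "b \<in> B" "x = b \<otimes> s" using B.coset_eqD[OF G s(2)] .
    obtain t where t: "t \<in> T" "C #> b = C #> t" using T b by blast
    have "t \<in> carrier G" "b \<in> carrier G" using t T b by auto
    then have "C #> x = C #> (t \<otimes> s)"
      unfolding b(2) using t(2) G by simp
    then show "\<exists>u\<in>?U. C #> x = C #> u" using s t by force
  qed
qed

text \<open>The \<open>p\<close>-th powers of representatives for \<open>A\<^sub>i/A\<^sub>i\<^sub>+\<^sub>1\<close> represent \<open>A\<^sub>i\<^sub>+\<^sub>1/A\<^sub>i\<^sub>+\<^sub>2\<close>, so every factor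
  inherits the bound for the first one.\<close>
lemma (in p_filtration) index_le_iterated:
  assumes q: "index_le G (A 0) (A (Suc 0)) q"
  shows "index_le G (A 0) (A n) (q ^ n)"
proof (induction n)
  case 0
  have "A 0 #> x = A 0 #> \<one>" if "x \<in> A 0" for x
    using that A_carrier[OF that] by (subst normal.coset_eq_iff[OF normal_A]) auto
  then show ?case by (intro index_leI[of "{\<one>}"]) auto
next
  case (Suc n)
  have "index_le G (A i) (A (Suc i)) q" for i
  proof (induction i)
    case (Suc i)
    obtain T where T: "finite T" "card T \<le> q" "T \<subseteq> A i"
      "\<And>x. x \<in> A i \<Longrightarrow> \<exists>t\<in>T. A (Suc i) #> x = A (Suc i) #> t"
      by (rule index_leE[OF Suc], rule that)
    show ?case
    proof (rule index_leI)
      show "finite ((\<lambda>t. t [^] p) ` T)" using T by simp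
      show "card ((\<lambda>t. t [^] p) ` T) \<le> q" using T card_image_le le_trans by blast
      fix x assume "x \<in> A (Suc i)"
      then obtain w where w: "w \<in> A i" "A (Suc (Suc i)) #> x = A (Suc (Suc i)) #> w [^] p"
        using power_surj by blast
      then obtain t where t: "t \<in> T" "A (Suc i) #> w = A (Suc i) #> t" using T by blast
      have "A (Suc (Suc i)) #> w [^] p = A (Suc (Suc i)) #> t [^] p"
        using w t T by (intro power_cong) auto
      then show "\<exists>u\<in>(\<lambda>t. t [^] p) ` T. A (Suc (Suc i)) #> x = A (Suc (Suc i)) #> u"
        using w t by auto
    qed
  qed (rule q)
  then have "index_le G (A 0) (A (Suc n)) (q ^ n * q)"
    using Suc by (intro index_le_trans[of "A n"] normal_A) (auto simp: A_carrier)
  then show ?case by (simp add: mult.commute)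
qed

text \<open>Modulo \<open>B\<close> the element \<open>s\<close> commutes with \<open>M\<close> and has order dividing \<open>p\<close>, so the generated
  subgroup consists of the products \<open>y s\<^sup>a\<close> with \<open>y \<in> M\<close> and \<open>a < p\<close>.\<close>
lemma (in group) index_le_adjoin:
  assumes B: "B \<lhd> G" and M: "subgroup M G" and s: "s \<in> carrier G"
    and comm: "\<And>y. y \<in> M \<Longrightarrow> \<langle>s, y\<rangle> \<in> B" and pow: "s [^] p \<in> B" and "0 < (p :: nat)"
    and "index_le G M B q"
  shows "index_le G (generate G (insert s M)) B (q * p)"
proof -
  interpret B: normal B G by fact
  let ?\<pi> = "(#>) B" and ?Q = "G Mod B"
  let ?Y = "{x \<in> carrier G. \<exists>y\<in>M. \<exists>a::nat. B #> x = B #> (y \<otimes> s [^] a)}"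
  have MG: "y \<in> carrier G" if "y \<in> M" for y using subgroup.mem_carrier[OF M that] .
  have \<sigma>: "(B #> s) \<in> carrier ?Q" using s by simp
  have \<sigma>p: "(B #> s) [^]\<^bsub>?Q\<^esub> p = \<one>\<^bsub>?Q\<^esub>"
    using pow s B.coset_eq_one_iff[of "s [^] p"] by (simp add: B.Q.hom_nat_pow)
  have swap: "(B #> s) [^]\<^bsub>?Q\<^esub> a \<otimes>\<^bsub>?Q\<^esub> (B #> y) = (B #> y) \<otimes>\<^bsub>?Q\<^esub> (B #> s) [^]\<^bsub>?Q\<^esub> a"
    if "y \<in> M" for a :: nat and y
    using comm[OF that] MG[OF that] s B.coset_commute_iff[of s y]
    by (intro B.Q.H.nat_pow_commute) (auto simp del: mult_FactGroup)
  have rep: "B #> (y \<otimes> s [^] a) = (B #> y) \<otimes>\<^bsub>?Q\<^esub> (B #> s) [^]\<^bsub>?Q\<^esub> a" if "y \<in> M" for a :: nat and y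
    using MG[OF that] s by (simp add: B.Q.hom_nat_pow del: mult_FactGroup)
  have "subgroup ?Y G"
  proof (rule subgroupI)
    have "\<one> \<in> ?Y" using subgroup.one_closed[OF M] by (auto intro!: bexI[of _ \<one>] exI[of _ 0])
    then show "?Y \<noteq> {}" by blast
  next
    fix x assume "x \<in> ?Y"
    then obtain y a where x: "x \<in> carrier G" and y: "y \<in> M" and eq: "B #> x = B #> (y \<otimes> s [^] (a::nat))"
      by blast
    (* Inverses stay in the set of products with natural exponents because s has order dividing p. *)
    have "(B #> s) [^]\<^bsub>?Q\<^esub> (a * (p - 1) + a) = ((B #> s) [^]\<^bsub>?Q\<^esub> p) [^]\<^bsub>?Q\<^esub> a"
      using \<sigma> \<open>0 < p\<close> by (simp add: B.Q.H.nat_pow_pow algebra_simps)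
    also have "\<dots> = \<one>\<^bsub>?Q\<^esub>" by (simp only: \<sigma>p B.Q.H.nat_pow_one)
    finally have "(B #> s) [^]\<^bsub>?Q\<^esub> (a * (p - 1)) \<otimes>\<^bsub>?Q\<^esub> (B #> s) [^]\<^bsub>?Q\<^esub> a = \<one>\<^bsub>?Q\<^esub>"
      using \<sigma> by (simp only: B.Q.H.nat_pow_mult)
    then have inv: "inv\<^bsub>?Q\<^esub> ((B #> s) [^]\<^bsub>?Q\<^esub> a) = (B #> s) [^]\<^bsub>?Q\<^esub> (a * (p - 1))"
      using \<sigma> by (intro B.Q.H.inv_equality B.Q.H.nat_pow_closed)
    have "B #> inv x = inv\<^bsub>?Q\<^esub> ((B #> y) \<otimes>\<^bsub>?Q\<^esub> (B #> s) [^]\<^bsub>?Q\<^esub> a)"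
      using x eq rep[OF y] by simp
    also have "\<dots> = (B #> s) [^]\<^bsub>?Q\<^esub> (a * (p - 1)) \<otimes>\<^bsub>?Q\<^esub> (B #> inv y)"
      using \<sigma> MG[OF y] inv by (simp add: B.Q.H.inv_mult_group del: mult_FactGroup)
    also have "\<dots> = B #> (inv y \<otimes> s [^] (a * (p - 1)))"
      using swap rep subgroup.m_inv_closed[OF M y] by simp
    finally show "inv x \<in> ?Y" using x subgroup.m_inv_closed[OF M y] by blast
  next
    fix x x' assume "x \<in> ?Y" "x' \<in> ?Y"
    then obtain y a y' a' where x: "x \<in> carrier G" "x' \<in> carrier G" and y: "y \<in> M" "y' \<in> M"
      and eq: "B #> x = B #> (y \<otimes> s [^] (a::nat))" "B #> x' = B #> (y' \<otimes> s [^] (a'::nat))"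
      by blast
    let ?s = "\<lambda>a::nat. (B #> s) [^]\<^bsub>?Q\<^esub> a"
    have "B #> (x \<otimes> x') = (B #> y) \<otimes>\<^bsub>?Q\<^esub> (?s a \<otimes>\<^bsub>?Q\<^esub> (B #> y')) \<otimes>\<^bsub>?Q\<^esub> ?s a'"
      using x y eq rep MG \<sigma> by (simp add: B.Q.H.m_assoc del: mult_FactGroup)
    also have "\<dots> = (B #> (y \<otimes> y')) \<otimes>\<^bsub>?Q\<^esub> ?s (a + a')"
      using y MG \<sigma> swap[OF y(2)]
      by (simp add: B.Q.H.m_assoc B.Q.H.nat_pow_mult[symmetric] del: mult_FactGroup)
    also have "\<dots> = B #> ((y \<otimes> y') \<otimes> s [^] (a + a'))"
      using rep subgroup.m_closed[OF M y] by simp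
    finally show "x \<otimes> x' \<in> ?Y" using x subgroup.m_closed[OF M y] by blast
  qed blast
  moreover have "insert s M \<subseteq> ?Y"
  proof -
    have "s \<in> ?Y" using s subgroup.one_closed[OF M] by (auto intro!: bexI[of _ \<one>] exI[of _ 1])
    moreover have "y \<in> ?Y" if "y \<in> M" for y
      using that MG by (auto intro!: bexI[of _ y] exI[of _ 0])
    ultimately show ?thesis by blast
  qed
  ultimately have Y: "generate G (insert s M) \<subseteq> ?Y" by (intro generate_subgroup_incl)
  obtain T where T: "finite T" "card T \<le> q" "T \<subseteq> M" "\<And>x. x \<in> M \<Longrightarrow> \<exists>t\<in>T. B #> x = B #> t"
    by (rule index_leE[OF assms(7)], rule that)
  show ?thesis
  proof (rule index_leI)
    let ?U = "(\<lambda>(t, a). t \<otimes> s [^] a) ` (T \<times> {..<p})"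
    show "finite ?U" using T by simp
    have "card ?U \<le> card T * p"
      using card_image_le[of "T \<times> {..<p}" "\<lambda>(t, a). t \<otimes> s [^] a"] T by (simp add: card_cartesian_product)
    also have "\<dots> \<le> q * p" using T by simp
    finally show "card ?U \<le> q * p" .
    fix x assume "x \<in> generate G (insert s M)"
    then obtain y a where y: "y \<in> M" and eq: "B #> x = B #> (y \<otimes> s [^] (a::nat))" using Y by blast
    obtain t where t: "t \<in> T" "B #> y = B #> t" using T y by blast
    have "(B #> s) [^]\<^bsub>?Q\<^esub> a = (B #> s) [^]\<^bsub>?Q\<^esub> (p * (a div p) + a mod p)" by simp
    also have "\<dots> = ((B #> s) [^]\<^bsub>?Q\<^esub> p) [^]\<^bsub>?Q\<^esub> (a div p) \<otimes>\<^bsub>?Q\<^esub> (B #> s) [^]\<^bsub>?Q\<^esub> (a mod p)"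
      using \<sigma> by (simp only: B.Q.H.nat_pow_pow B.Q.H.nat_pow_mult)
    also have "\<dots> = (B #> s) [^]\<^bsub>?Q\<^esub> (a mod p)"
      using \<sigma> by (simp add: \<sigma>p del: mult_FactGroup one_FactGroup)
    finally have "B #> x = B #> (t \<otimes> s [^] (a mod p))"
      using eq rep[OF y] rep[of t "a mod p"] t T by (auto simp del: mult_FactGroup)
    then show "\<exists>u\<in>?U. B #> x = B #> u" using t \<open>0 < p\<close> by force
  qed
qed

lemma (in group) index_le_generate:
  assumes B: "B \<lhd> G" and N: "subgroup N G" and "B \<subseteq> N" and "0 < (p :: nat)"
    and comm: "\<And>x y. x \<in> N \<Longrightarrow> y \<in> N \<Longrightarrow> \<langle>x, y\<rangle> \<in> B"
    and pow: "\<And>x. x \<in> N \<Longrightarrow> x [^] p \<in> B"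
    and "finite S" "S \<subseteq> N"
  shows "index_le G (generate G (S \<union> B)) B (p ^ card S)"
  using assms(7,8)
proof (induction S)
  case empty
  interpret B: normal B G by fact
  have "generate G ({} \<union> B) = B"
    using generateI[OF B.subgroup_axioms order_refl] by simp
  moreover have "B #> x = B #> \<one>" if "x \<in> B" for x
    using that by (subst B.coset_eq_iff) auto
  ultimately show ?case by (intro index_leI[of "{\<one>}"]) auto
next
  case (insert s S)
  let ?M = "generate G (S \<union> B)"
  have NG: "N \<subseteq> carrier G" using N by (rule subgroup.subset)
  have M: "?M \<subseteq> N" using insert.prems \<open>B \<subseteq> N\<close> N by (intro generate_subgroup_incl) auto
  have "index_le G (generate G (insert s ?M)) B (p ^ card S * p)"
  proof (rule index_le_adjoin[OF B])
    show "subgroup ?M G" using insert.prems \<open>B \<subseteq> N\<close> NG by (intro generate_is_subgroup) auto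
  qed (use insert comm pow NG M \<open>0 < p\<close> in auto)
  moreover have "generate G (insert s S \<union> B) \<subseteq> generate G (insert s ?M)"
    by (intro mono_generate) (auto intro: generate.incl)
  ultimately show ?case
    by (rule index_le_mono) (use insert.hyps in simp)
qed

section \<open>Basic commutators span the lower central factors\<close>

subsection \<open>Commutators of lower central terms\<close>

context group
begin

lemma middle_factor:
  assumes "a \<in> carrier G" "b \<in> carrier G" "c \<in> carrier G" "a \<otimes> b \<otimes> c = \<one>"
  shows "b = inv a \<otimes> inv c"
proof -
  have "b = inv a \<otimes> (a \<otimes> b \<otimes> c) \<otimes> inv c" using assms(1-3) by (simp add: m_assoc)
  then show ?thesis using assms by simp
qed

text \<open>The Hall-Witt identity, applied to \<open>c\<^sup>-\<^sup>1 a c\<close> in place of \<open>a\<close> so that its middle factor is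
  exactly \<open>[[b, c], a]\<close>.\<close>
lemma three_subgroups:
  assumes T: "T \<lhd> G" and A: "A \<lhd> G" and B: "B \<lhd> G" and C: "C \<lhd> G"
    and AB: "\<And>a b c. a \<in> A \<Longrightarrow> b \<in> B \<Longrightarrow> c \<in> C \<Longrightarrow> \<langle>\<langle>a, b\<rangle>, c\<rangle> \<in> T"
    and CA: "\<And>a b c. a \<in> A \<Longrightarrow> b \<in> B \<Longrightarrow> c \<in> C \<Longrightarrow> \<langle>\<langle>c, a\<rangle>, b\<rangle> \<in> T"
    and a: "a \<in> A" and b: "b \<in> B" and c: "c \<in> C"
  shows "\<langle>\<langle>b, c\<rangle>, a\<rangle> \<in> T"
proof -
  interpret T: normal T G by fact
  interpret A: normal A G by fact
  interpret B: normal B G by fact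
  interpret C: normal C G by fact
  have G: "a \<in> carrier G" "b \<in> carrier G" "c \<in> carrier G" using a b c by auto
  let ?a = "inv c \<otimes> a \<otimes> c"
  have a': "?a \<in> A" using G a by (intro A.inv_op_closed1)
  have u: "\<langle>\<langle>?a, b\<rangle>, b \<otimes> c \<otimes> inv b\<rangle> \<in> T" (is "?u \<in> T")
    using a' b G c by (intro AB C.inv_op_closed2)
  have w: "\<langle>\<langle>c, ?a\<rangle>, ?a \<otimes> b \<otimes> inv ?a\<rangle> \<in> T" (is "?w \<in> T")
    using a' b G c by (intro CA B.inv_op_closed2) auto
  have "?u \<otimes> \<langle>\<langle>b, c\<rangle>, c \<otimes> ?a \<otimes> inv c\<rangle> \<otimes> ?w = \<one>"
    using G by (intro Hall_Witt) auto
  moreover have "c \<otimes> ?a \<otimes> inv c = a" using G by (simp add: m_assoc)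
  ultimately have "?u \<otimes> \<langle>\<langle>b, c\<rangle>, a\<rangle> \<otimes> ?w = \<one>" by simp
  then have "\<langle>\<langle>b, c\<rangle>, a\<rangle> = inv ?u \<otimes> inv ?w"
    using G by (intro middle_factor) auto
  also have "\<dots> \<in> T"
    by (intro subgroup.m_closed[OF T.subgroup_axioms T.m_inv_closed[OF u] T.m_inv_closed[OF w]])
  finally show ?thesis .
qed

lemma iter_comm_normal: "N \<lhd> G \<Longrightarrow> iter_comm G N k \<lhd> G"
  by (induction k) (simp_all add: comm_subgroup_normal normal_self)

lemma iter_comm_mono: "N \<subseteq> N' \<Longrightarrow> iter_comm G N k \<subseteq> iter_comm G N' k"
  by (induction k) (simp_all add: comm_subgroup_mono)

lemma iter_comm_Suc_shift: "iter_comm G N (Suc k) = iter_comm G (comm_subgroup G N (carrier G)) k"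
  by (induction k) simp_all

text \<open>This is \<open>[[N, \<^sub>aG], \<gamma>\<^sub>b\<^sub>+\<^sub>1(G)] \<subseteq> [N, \<^sub>a\<^sub>+\<^sub>b\<^sub>+\<^sub>1G]\<close>, by induction on \<open>b\<close>: the three subgroups lemma moves
  the last \<open>G\<close> out of \<open>\<gamma>\<^sub>b\<^sub>+\<^sub>2(G) = [\<gamma>\<^sub>b\<^sub>+\<^sub>1(G), G]\<close>.\<close>
lemma iter_comm_commutator:
  assumes N: "N \<lhd> G"
  shows "x \<in> iter_comm G N a \<Longrightarrow> y \<in> iter_comm G (carrier G) b \<Longrightarrow> \<langle>x, y\<rangle> \<in> iter_comm G N (Suc (a + b))"
proof (induction b arbitrary: a x y)
  case 0
  then show ?case by (simp add: comm_subgroup_incl)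
next
  case (Suc b)
  let ?T = "iter_comm G N (Suc (a + Suc b))" and ?A = "iter_comm G N a"
    and ?B = "iter_comm G (carrier G) b"
  have T: "?T \<lhd> G" and A: "?A \<lhd> G" and B: "?B \<lhd> G"
    by (simp_all add: iter_comm_normal N normal_self del: iter_comm.simps)
  interpret T: normal ?T G by (rule T)
  interpret A: normal ?A G by (rule A)
  have "\<langle>\<langle>b', c\<rangle>, a'\<rangle> \<in> ?T" if "a' \<in> ?A" "b' \<in> ?B" "c \<in> carrier G" for a' b' c
  proof (rule three_subgroups[OF T A B normal_self _ _ that])
    fix a' b' c assume *: "a' \<in> ?A" "b' \<in> ?B" "c \<in> carrier G"
    show "\<langle>\<langle>a', b'\<rangle>, c\<rangle> \<in> ?T"
      using Suc.IH[OF *(1,2)] *(3) by (simp add: comm_subgroup_incl)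
    have "\<langle>a', c\<rangle> \<in> iter_comm G N (Suc a)" using * by (simp add: comm_subgroup_incl)
    then have "\<langle>c, a'\<rangle> \<in> iter_comm G N (Suc a)"
      using * A.mem_carrier[OF *(1)] iter_comm_normal[OF N] by (intro normal.commutator_swap_in[of _ G a' c])
    then show "\<langle>\<langle>c, a'\<rangle>, b'\<rangle> \<in> ?T" using Suc.IH[of "\<langle>c, a'\<rangle>" "Suc a" b'] * by simp
  qed
  then have "iter_comm G (carrier G) (Suc b) \<subseteq> centralizer_mod G ?A ?T"
    using subgroup.mem_carrier[OF normal_imp_subgroup[OF B]]
    unfolding iter_comm.simps(2)[of G "carrier G" b]
    by (intro comm_subgroup_least centralizer_mod_subgroup T A.subset) (auto simp: centralizer_mod_def)
  then have "\<langle>y, x\<rangle> \<in> ?T" "y \<in> carrier G"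
    using Suc.prems by (auto simp: centralizer_mod_def simp del: iter_comm.simps)
  then show ?case by (intro T.commutator_swap_in[OF _ A.mem_carrier[OF Suc.prems(1)]])
qed

end

subsection \<open>The order of basic commutators\<close>

lemma comm_less_irrefl: "\<not> comm_less u u"
  by (induction u) auto

lemma comm_less_trans: "comm_less u v \<Longrightarrow> comm_less v w \<Longrightarrow> comm_less u w"
proof (induction u arbitrary: v w)
  case (Letter i)
  then show ?case by (cases v; cases w) auto
next
  case (Comm u1 u2)
  then show ?case by (cases v; cases w) auto
qed

lemma comm_less_total: "comm_less u v \<or> u = v \<or> comm_less v u"
proof (induction u arbitrary: v)
  case (Letter i)
  then show ?case by (cases v) auto
next
  case IH: (Comm u1 u2)
  show ?case
  proof (cases v)
    case (Comm v1 v2)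
    then show ?thesis using IH.IH(1)[of v1] IH.IH(2)[of v2]
      by (cases "weight u1 + weight u2" "weight v1 + weight v2" rule: linorder_cases) auto
  qed simp
qed

lemma comm_less_if_weight_less: "weight u < weight v \<Longrightarrow> comm_less u v"
proof (cases u; cases v)
  fix u1 u2 j assume *: "weight u < weight v" "u = Comm u1 u2" "v = Letter j"
  then show "comm_less u v" using weight_pos[of u1] weight_pos[of u2] by simp
qed auto

subsection \<open>The Lie ring of lower central factors\<close>

primrec eval_comm :: "('a, 'm) monoid_scheme \<Rightarrow> (nat \<Rightarrow> 'a) \<Rightarrow> comm \<Rightarrow> 'a" where
  "eval_comm G x (Letter i) = x i"
| "eval_comm G x (Comm u v) = \<langle>eval_comm G x u, eval_comm G x v\<rangle>\<^bsub>G\<^esub>"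

text \<open>With \<open>M\<^sub>n = [K, G, \<dots>, G]\<close> (\<open>n - 1\<close> copies of \<open>G\<close>), the inclusion \<open>G' \<subseteq> K\<close> gives \<open>\<gamma>\<^sub>n\<^sub>+\<^sub>1 \<subseteq> M\<^sub>n\<close>. So
  the factors \<open>\<gamma>\<^sub>n/M\<^sub>n\<close> are central, commutators are bilinear on them, and they form a graded Lie
  ring generated by the images of \<open>x\<^sub>0, \<dots>, x\<^sub>d\<^sub>-\<^sub>1\<close> in degree one. Its calculations are carried out in
  the group, with \<open>basic_span n\<close> the preimage of the span of the basic commutators of weight
  \<open>n\<close>.\<close>
locale generated_mod = group +
  fixes K :: "'a set" and d :: nat and x :: "nat \<Rightarrow> 'a"
  assumes K: "K \<lhd> G"
    and x_closed: "x i \<in> carrier G"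
    and generates: "carrier G \<subseteq> generate G (x ` {..<d} \<union> K)"
    and commutator_in_K: "g \<in> carrier G \<Longrightarrow> h \<in> carrier G \<Longrightarrow> \<langle>g, h\<rangle> \<in> K"
begin

abbreviation "\<Gamma> \<equiv> lower_central G"

definition M :: "nat \<Rightarrow> 'a set" where
  "M n = iter_comm G K (n - 1)"

abbreviation "ev \<equiv> eval_comm G x"

definition basic_span :: "nat \<Rightarrow> 'a set" where
  "basic_span n = generate G (ev ` {w. basic_comm d w \<and> weight w = n} \<union> M n)"

lemma \<Gamma>_normal: "\<Gamma> n \<lhd> G"
  by (simp add: lower_central_def iter_comm_normal normal_self)

lemma M_normal: "M n \<lhd> G"
  by (simp add: M_def iter_comm_normal K)

lemma \<Gamma>_closed: "g \<in> \<Gamma> n \<Longrightarrow> g \<in> carrier G"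
  using \<Gamma>_normal by (meson normal_imp_subgroup subgroup.mem_carrier)

lemma M_closed: "g \<in> M n \<Longrightarrow> g \<in> carrier G"
  using M_normal by (meson normal_imp_subgroup subgroup.mem_carrier)

lemma M_subset_\<Gamma>: "M n \<subseteq> \<Gamma> n"
  unfolding M_def lower_central_def
  by (intro iter_comm_mono) (simp add: K normal_imp_subgroup subgroup.subset)

lemma \<Gamma>_commutator: "g \<in> \<Gamma> m \<Longrightarrow> h \<in> \<Gamma> n \<Longrightarrow> 0 < m \<Longrightarrow> 0 < n \<Longrightarrow> \<langle>g, h\<rangle> \<in> \<Gamma> (m + n)"
  using iter_comm_commutator[OF normal_self, of g "m - 1" h "n - 1"]
  by (auto simp: lower_central_def gr0_conv_Suc simp del: iter_comm.simps)

lemma M_commutator: "g \<in> M m \<Longrightarrow> h \<in> \<Gamma> n \<Longrightarrow> 0 < m \<Longrightarrow> 0 < n \<Longrightarrow> \<langle>g, h\<rangle> \<in> M (m + n)"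
  using iter_comm_commutator[OF K, of g "m - 1" h "n - 1"]
  by (auto simp: lower_central_def M_def gr0_conv_Suc simp del: iter_comm.simps)

lemma \<Gamma>_Suc_subset: "\<Gamma> (Suc n) \<subseteq> \<Gamma> n"
proof (cases n)
  case (Suc m)
  then show ?thesis
    using comm_subgroup_subset[OF iter_comm_normal[OF normal_self, of m]] by (simp add: lower_central_def)
qed (simp add: lower_central_def)

lemma \<Gamma>_antimono: "m \<le> n \<Longrightarrow> \<Gamma> n \<subseteq> \<Gamma> m"
  by (rule lift_Suc_antimono_le) (rule \<Gamma>_Suc_subset)

lemma \<Gamma>_Suc_subset_M: "0 < n \<Longrightarrow> \<Gamma> (Suc n) \<subseteq> M n"
proof (cases n)
  case (Suc m)
  have "comm_subgroup G (carrier G) (carrier G) \<subseteq> K"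
    using commutator_in_K by (intro comm_subgroup_least normal_imp_subgroup[OF K])
  then have "iter_comm G (comm_subgroup G (carrier G) (carrier G)) m \<subseteq> iter_comm G K m"
    by (rule iter_comm_mono)
  then show ?thesis using Suc by (simp add: lower_central_def M_def iter_comm_Suc_shift del: iter_comm.simps)
qed simp

lemma ev_in_\<Gamma>: "ev w \<in> \<Gamma> (weight w)"
proof (induction w)
  case (Letter i)
  then show ?case by (simp add: lower_central_def x_closed)
next
  case (Comm u v)
  then show ?case by (simp add: \<Gamma>_commutator weight_pos)
qed

lemma ev_closed: "ev w \<in> carrier G"
  using ev_in_\<Gamma> \<Gamma>_closed by blast

lemma basic_span_generators: "ev ` {w. basic_comm d w \<and> weight w = n} \<union> M n \<subseteq> \<Gamma> n"
  using ev_in_\<Gamma> M_subset_\<Gamma> by auto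

lemma basic_span_subset: "basic_span n \<subseteq> \<Gamma> n"
  unfolding basic_span_def by (intro generate_subgroup_incl basic_span_generators normal_imp_subgroup[OF \<Gamma>_normal])

lemma M_subset_span: "M n \<subseteq> basic_span n"
  unfolding basic_span_def by (auto intro: generate.incl)

lemma ev_in_span: "basic_comm d w \<Longrightarrow> ev w \<in> basic_span (weight w)"
  unfolding basic_span_def by (auto intro: generate.incl)

text \<open>Conjugation changes an element of \<open>\<gamma>\<^sub>n\<close> by an element of \<open>\<gamma>\<^sub>n\<^sub>+\<^sub>1 \<subseteq> M\<^sub>n\<close>.\<close>
lemma basic_span_normal:
  assumes "0 < n"
  shows "basic_span n \<lhd> G"
proof (rule normal_invI)
  have "\<Gamma> n \<subseteq> carrier G" using \<Gamma>_closed by blast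
  then show sub: "subgroup (basic_span n) G"
    unfolding basic_span_def using basic_span_generators by (intro generate_is_subgroup) blast
  fix g s assume g: "g \<in> carrier G" and s: "s \<in> basic_span n"
  have sG: "s \<in> carrier G" using subgroup.mem_carrier[OF sub s] .
  have "\<langle>s, g\<rangle> \<in> \<Gamma> (Suc n)"
    using \<Gamma>_commutator[of s n g 1] s basic_span_subset g assms by (auto simp: lower_central_def)
  then have "\<langle>g, s\<rangle> \<in> basic_span n"
    using \<Gamma>_Suc_subset_M[OF assms] M_subset_span normal.commutator_swap_in[OF \<Gamma>_normal sG g] by blast
  then have "\<langle>g, s\<rangle> \<otimes> s \<in> basic_span n" by (rule subgroup.m_closed[OF sub _ s])
  then show "g \<otimes> s \<otimes> inv g \<in> basic_span n" using g sG by (simp add: word_simps)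
qed

lemma basic_span_commutator_left:
  assumes "0 < m" "0 < n" and h: "h \<in> \<Gamma> n"
    and basic: "\<And>w. basic_comm d w \<Longrightarrow> weight w = m \<Longrightarrow> \<langle>ev w, h\<rangle> \<in> basic_span (m + n)"
    and g: "g \<in> basic_span m"
  shows "\<langle>g, h\<rangle> \<in> basic_span (m + n)"
proof -
  have hG: "h \<in> carrier G" using h \<Gamma>_closed by blast
  have "basic_span m \<subseteq> centralizer_mod G {h} (basic_span (m + n))"
    unfolding basic_span_def[of m]
  proof (rule generate_subgroup_incl)
    show "subgroup (centralizer_mod G {h} (basic_span (m + n))) G"
      using basic_span_normal assms(1) hG by (intro centralizer_mod_subgroup) auto
    have "\<langle>k, h\<rangle> \<in> basic_span (m + n)" if "k \<in> M m" for k
      using M_commutator[OF that h assms(1,2)] M_subset_span by blast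
    then show "ev ` {w. basic_comm d w \<and> weight w = m} \<union> M m \<subseteq> centralizer_mod G {h} (basic_span (m + n))"
      using basic ev_closed M_closed by (auto simp: centralizer_mod_def)
  qed
  then show ?thesis using g by (auto simp: centralizer_mod_def)
qed

text \<open>Bilinearity of the Lie bracket, in the form in which it is used: it suffices to treat brackets
  of basic commutators.\<close>
lemma basic_span_commutator:
  assumes "0 < m" "0 < n"
    and basic: "\<And>u v. basic_comm d u \<Longrightarrow> basic_comm d v \<Longrightarrow> weight u = m \<Longrightarrow> weight v = n \<Longrightarrow>
                  \<langle>ev u, ev v\<rangle> \<in> basic_span (m + n)"
    and g: "g \<in> basic_span m" and h: "h \<in> basic_span n"
  shows "\<langle>g, h\<rangle> \<in> basic_span (m + n)"
proof -
  interpret S: normal "basic_span (m + n)" G using assms(1) by (intro basic_span_normal) simp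
  have gh: "g \<in> \<Gamma> m" "h \<in> \<Gamma> n" using g h basic_span_subset by blast+
  have "\<langle>ev w, g\<rangle> \<in> basic_span (n + m)" if w: "basic_comm d w" "weight w = n" for w
  proof -
    have "\<langle>g, ev w\<rangle> \<in> basic_span (m + n)"
    proof (rule basic_span_commutator_left[OF assms(1,2) _ _ g])
      show "ev w \<in> \<Gamma> n" using ev_in_\<Gamma>[of w] w(2) by simp
    qed (rule basic[OF _ w(1) _ w(2)])
    then show ?thesis
      using S.commutator_swap_in[of g "ev w"] \<Gamma>_closed[OF gh(1)] ev_closed by (simp add: add.commute)
  qed
  then have "\<langle>h, g\<rangle> \<in> basic_span (n + m)"
    by (rule basic_span_commutator_left[OF assms(2,1) gh(1) _ h])
  then have "\<langle>h, g\<rangle> \<in> basic_span (m + n)" by (simp only: add.commute)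
  then show ?thesis by (rule S.commutator_swap_in[OF \<Gamma>_closed[OF gh(2)] \<Gamma>_closed[OF gh(1)]])
qed

text \<open>The conjugations in the Hall-Witt identity alter an entry by a commutator of higher weight,
  which changes the double commutator only by an element of \<open>\<gamma>\<^sub>a\<^sub>+\<^sub>b\<^sub>+\<^sub>c\<^sub>+\<^sub>1 \<subseteq> T\<close>. What remains is the
  Jacobi identity.\<close>
lemma Jacobi:
  assumes T: "T \<lhd> G" and "\<Gamma> (Suc (a + b + c)) \<subseteq> T" and pos: "0 < a" "0 < b" "0 < c"
    and s: "s \<in> \<Gamma> a" and t: "t \<in> \<Gamma> b" and v: "v \<in> \<Gamma> c"
    and sv: "\<langle>\<langle>s, v\<rangle>, t\<rangle> \<in> T" and tv: "\<langle>\<langle>t, v\<rangle>, s\<rangle> \<in> T"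
  shows "\<langle>\<langle>s, t\<rangle>, v\<rangle> \<in> T"
proof -
  interpret T: normal T G by fact
  have G: "s \<in> carrier G" "t \<in> carrier G" "v \<in> carrier G" using s t v \<Gamma>_closed by blast+
  have conj: "\<langle>w, f \<otimes> h \<otimes> inv f\<rangle> \<in> T \<longleftrightarrow> \<langle>w, h\<rangle> \<in> T"
    if w: "w \<in> \<Gamma> m" and f: "f \<in> \<Gamma> k" and h: "h \<in> \<Gamma> l" and "0 < m" "0 < k" "0 < l" "m + k + l > a + b + c"
    for w f h m k l
  proof -
    have wG: "w \<in> carrier G" "f \<in> carrier G" "h \<in> carrier G" using w f h \<Gamma>_closed by blast+
    let ?C = "centralizer_mod G {w} T"
    have C: "subgroup ?C G" using wG by (intro centralizer_mod_subgroup T) auto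
    have "\<langle>w, \<langle>f, h\<rangle>\<rangle> \<in> \<Gamma> (m + (k + l))" using that by (intro \<Gamma>_commutator) auto
    then have "\<langle>w, \<langle>f, h\<rangle>\<rangle> \<in> T" using \<Gamma>_antimono[of "Suc (a + b + c)" "m + (k + l)"] that assms(2) by auto
    then have fh: "\<langle>f, h\<rangle> \<in> ?C" using wG by (auto simp: centralizer_mod_def intro: T.commutator_swap_in)
    have mem: "g \<in> ?C \<longleftrightarrow> \<langle>w, g\<rangle> \<in> T" if "g \<in> carrier G" for g
      using that wG T.commutator_swap_in[of w g] T.commutator_swap_in[of g w] by (auto simp: centralizer_mod_def)
    have "f \<otimes> h \<otimes> inv f \<in> ?C \<longleftrightarrow> h \<in> ?C"
    proof
      assume "f \<otimes> h \<otimes> inv f \<in> ?C"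
      then have "inv \<langle>f, h\<rangle> \<otimes> (f \<otimes> h \<otimes> inv f) \<in> ?C"
        using subgroup.m_closed[OF C subgroup.m_inv_closed[OF C fh]] by blast
      then show "h \<in> ?C" using wG by (simp add: word_simps)
    next
      assume "h \<in> ?C"
      then have "\<langle>f, h\<rangle> \<otimes> h \<in> ?C" using subgroup.m_closed[OF C fh] by blast
      then show "f \<otimes> h \<otimes> inv f \<in> ?C" using wG by (simp add: word_simps)
    qed
    then show ?thesis using mem wG by simp
  qed
  have 2: "\<langle>\<langle>t, v\<rangle>, v \<otimes> s \<otimes> inv v\<rangle> \<in> T"
    using conj[OF \<Gamma>_commutator[OF t v] v s] pos tv by simp
  have "\<langle>s, v\<rangle> \<in> centralizer_mod G {t} T" using sv G by (simp add: centralizer_mod_def)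
  then have "inv \<langle>s, v\<rangle> \<in> centralizer_mod G {t} T"
    using G by (intro subgroup.m_inv_closed[OF centralizer_mod_subgroup[OF T]]) auto
  then have "\<langle>\<langle>v, s\<rangle>, t\<rangle> \<in> T" using G by (simp add: centralizer_mod_def inv_commutator)
  then have 3: "\<langle>\<langle>v, s\<rangle>, s \<otimes> t \<otimes> inv s\<rangle> \<in> T"
    using conj[OF \<Gamma>_commutator[OF v s] s t] pos by simp
  have "\<langle>\<langle>s, t\<rangle>, t \<otimes> v \<otimes> inv t\<rangle> \<otimes> (\<langle>\<langle>t, v\<rangle>, v \<otimes> s \<otimes> inv v\<rangle> \<otimes> \<langle>\<langle>v, s\<rangle>, s \<otimes> t \<otimes> inv s\<rangle>) = \<one>"
    using Hall_Witt[OF G] G by (simp add: m_assoc)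
  then have "\<langle>\<langle>s, t\<rangle>, t \<otimes> v \<otimes> inv t\<rangle> = inv (\<langle>\<langle>t, v\<rangle>, v \<otimes> s \<otimes> inv v\<rangle> \<otimes> \<langle>\<langle>v, s\<rangle>, s \<otimes> t \<otimes> inv s\<rangle>)"
    using G by (intro inv_equality[symmetric]) auto
  then have "\<langle>\<langle>s, t\<rangle>, t \<otimes> v \<otimes> inv t\<rangle> \<in> T"
    using T.m_inv_closed[OF subgroup.m_closed[OF T.subgroup_axioms 2 3]] by simp
  then show ?thesis using conj[OF \<Gamma>_commutator[OF s t] t v] pos by simp
qed

text \<open>Hall's rewriting argument, by induction on the weight \<open>n\<close> and, for fixed \<open>n\<close>, by descending
  induction on the smaller factor \<open>v\<close> of a bracket \<open>[u, v]\<close>. If \<open>[u, v]\<close> is not basic, then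
  \<open>u = [s, t]\<close> with \<open>s > t > v\<close>, and the Jacobi identity expresses \<open>[[s, t], v]\<close> by \<open>[[s, v], t]\<close>
  and \<open>[[t, v], s]\<close>. By induction on the weight, \<open>[s, v]\<close> and \<open>[t, v]\<close> are combinations of basic
  commutators \<open>w\<close>; these exceed \<open>v\<close> because their weight does. Both factors of the new brackets
  \<open>[w, t]\<close> and \<open>[w, s]\<close> are thus larger than \<open>v\<close>, and the inner induction applies.\<close>
lemma basic_commutator_in_span:
  "basic_comm d u \<Longrightarrow> basic_comm d v \<Longrightarrow> weight u + weight v = n \<Longrightarrow> \<langle>ev u, ev v\<rangle> \<in> basic_span n"
proof (induction n arbitrary: u v rule: less_induct)
  case (less n)
  note outer_IH = less.IH
  let ?B = "{w. basic_comm d w \<and> weight w < n}"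
  have finB: "finite ?B"
  proof -
    have "?B = (\<Union>m<n. {w. basic_comm d w \<and> weight w = m})" by auto
    then show ?thesis using finite_basic_comms by auto
  qed
  have npos: "0 < n" using less.prems(3) weight_pos[of u] by simp
  interpret S: normal "basic_span n" G using npos by (rule basic_span_normal)
  define P where "P v \<longleftrightarrow> (\<forall>u. basic_comm d u \<longrightarrow> weight u + weight v = n \<longrightarrow>
      comm_less v u \<longrightarrow> \<langle>ev u, ev v\<rangle> \<in> basic_span n)" for v
  have PD: "\<langle>ev u, ev v\<rangle> \<in> basic_span n"
    if "P v" "basic_comm d u" "weight u + weight v = n" "comm_less v u" for u v
    using that unfolding P_def by blast
  have of_smaller: "\<langle>ev u, ev v\<rangle> \<in> basic_span n"
    if uv: "basic_comm d u" "basic_comm d v" "weight u + weight v = n" and P: "P u" "P v" for u v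
  proof -
    consider "comm_less v u" | "u = v" | "comm_less u v" using comm_less_total by blast
    then show ?thesis
    proof cases
      case 1
      then show ?thesis by (rule PD[OF P(2) uv(1,3)])
    next
      case 2
      then show ?thesis using commutator_self[OF ev_closed] by simp
    next
      case 3
      have "weight v + weight u = n" using uv(3) by simp
      then have "\<langle>ev v, ev u\<rangle> \<in> basic_span n" using 3 by (rule PD[OF P(1) uv(2)])
      then show ?thesis by (rule S.commutator_swap_in[OF ev_closed ev_closed])
    qed
  qed
  have P: "P v" if "basic_comm d v" for v
    using that
  proof (induction v rule: measure_induct_rule[of "\<lambda>v. card {w \<in> ?B. comm_less v w}"])
    case (less v)
    note inner = less.IH and v = less.prems
    (* The number of basic commutators above v measures the descent. A w of weight at least n
       cannot be a factor of a bracket of weight n, so P w then holds vacuously. *)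
    have larger: "P w" if w: "basic_comm d w" "comm_less v w" for w
    proof (cases "weight w < n")
      case True
      have "{z \<in> ?B. comm_less w z} \<subseteq> {z \<in> ?B. comm_less v z}"
        using comm_less_trans[OF w(2)] by blast
      moreover have "w \<in> {z \<in> ?B. comm_less v z} - {z \<in> ?B. comm_less w z}"
        using w True comm_less_irrefl[of w] by simp
      ultimately have "{z \<in> ?B. comm_less w z} \<subset> {z \<in> ?B. comm_less v z}" by blast
      moreover have "finite {z \<in> ?B. comm_less v z}" using finB by (rule rev_finite_subset) blast
      ultimately have "card {z \<in> ?B. comm_less w z} < card {z \<in> ?B. comm_less v z}"
        by (intro psubset_card_mono)
      then show ?thesis using w(1) by (rule inner)
    next
      case False
      then have "weight u + weight w \<noteq> n" for u using weight_pos[of u] by simp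
      then show ?thesis unfolding P_def by blast
    qed
    show ?case unfolding P_def
    proof (intro allI impI)
      fix u assume u: "basic_comm d u" "weight u + weight v = n" "comm_less v u"
      show "\<langle>ev u, ev v\<rangle> \<in> basic_span n"
      proof (cases "basic_comm d (Comm u v)")
        case True
        then show ?thesis using ev_in_span[OF True] u(2) by simp
      next
        case False
        obtain s t where st: "u = Comm s t" "t \<noteq> v" "\<not> comm_less t v"
        proof (cases u)
          case (Letter i)
          then show ?thesis using False u v by simp
        next
          case (Comm s t)
          then show ?thesis using False u v by (intro that[of s t]) auto
        qed
        then have vt: "comm_less v t" using comm_less_total[of v t] by blast
        have s: "basic_comm d s" and t: "basic_comm d t" and ts: "comm_less t s"
          using u(1) st(1) by simp_all
        have n: "n = weight s + weight t + weight v" using u(2) st(1) by simp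
        note pos = weight_pos[of s] weight_pos[of t] weight_pos[of v]
        have outer: "\<langle>\<langle>ev y, ev v\<rangle>, ev z\<rangle> \<in> basic_span n"
          if y: "basic_comm d y" and z: "basic_comm d z" "comm_less v z"
            and yz: "weight y + weight v + weight z = n" for y z
        proof -
          have "\<langle>ev y, ev v\<rangle> \<in> basic_span (weight y + weight v)"
            using yz weight_pos[of z] by (intro outer_IH[OF _ y v]) simp_all
          moreover have "\<langle>ev w, ev z\<rangle> \<in> basic_span n"
            if w: "basic_comm d w" "weight w = weight y + weight v" for w
          proof (rule of_smaller[OF w(1) z(1)])
            have "comm_less v w" using w(2) weight_pos[of y] by (intro comm_less_if_weight_less) simp
            then show "P w" by (rule larger[OF w(1)])
            show "P z" by (rule larger[OF z])
          qed (use w(2) yz in simp)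
          ultimately show ?thesis
            using basic_span_commutator_left[of "weight y + weight v" "weight z" "ev z" "\<langle>ev y, ev v\<rangle>"]
              ev_in_\<Gamma>[of z] weight_pos[of y] weight_pos[of z] yz by simp
        qed
        have "\<langle>\<langle>ev s, ev t\<rangle>, ev v\<rangle> \<in> basic_span n"
        proof (rule Jacobi[OF S.normal_axioms _ pos ev_in_\<Gamma> ev_in_\<Gamma> ev_in_\<Gamma>])
          show "\<Gamma> (Suc (weight s + weight t + weight v)) \<subseteq> basic_span n"
            using \<Gamma>_Suc_subset_M[OF npos] M_subset_span[of n] unfolding n by blast
          show "\<langle>\<langle>ev s, ev v\<rangle>, ev t\<rangle> \<in> basic_span n" using n by (intro outer s t vt) simp
          show "\<langle>\<langle>ev t, ev v\<rangle>, ev s\<rangle> \<in> basic_span n"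
            using n by (intro outer s t comm_less_trans[OF vt ts]) simp
        qed
        then show ?thesis using st(1) by simp
      qed
    qed
  qed
  show ?case by (rule of_smaller[OF less.prems P P]) (rule less.prems)+
qed

theorem lower_central_subset_basic_span: "0 < n \<Longrightarrow> \<Gamma> n \<subseteq> basic_span n"
proof (induction n)
  case (Suc n)
  have one: "carrier G \<subseteq> basic_span 1"
  proof -
    have "x ` {..<d} \<union> K \<subseteq> basic_span 1"
      using ev_in_span[of "Letter i" for i] M_subset_span[of 1] by (auto simp: M_def)
    then have "generate G (x ` {..<d} \<union> K) \<subseteq> basic_span 1"
      by (intro generate_subgroup_incl normal_imp_subgroup[OF basic_span_normal]) auto
    then show ?thesis using generates by blast
  qed
  show ?case
  proof (cases "n = 0")
    case True
    then show ?thesis using one by (simp add: lower_central_def)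
  next
    case False
    then have "\<Gamma> (Suc n) = comm_subgroup G (\<Gamma> n) (carrier G)"
      by (auto simp: lower_central_def gr0_conv_Suc)
    also have "\<dots> \<subseteq> basic_span (n + 1)"
    proof (rule comm_subgroup_least)
      fix g h assume "g \<in> \<Gamma> n" "h \<in> carrier G"
      then have "g \<in> basic_span n" "h \<in> basic_span 1" using Suc.IH False one by auto
      then show "\<langle>g, h\<rangle> \<in> basic_span (n + 1)"
        using False by (intro basic_span_commutator[of n 1 g h] basic_commutator_in_span) simp_all
    qed (simp add: normal_imp_subgroup basic_span_normal)
    finally show ?thesis by simp
  qed
qed simp

end

section \<open>The order of the nilpotent multiplier\<close>

text \<open>The first factor of the series \<open>[A\<^sub>i, G, \<dots>, G]\<close> is abelian of exponent dividing \<open>p\<close> and spanned by the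
  basic commutators of weight \<open>c + 1\<close>, and it bounds the other factors.\<close>
lemma (in p_filtration) index_le_lower_central:
  assumes A0: "A 0 = carrier G" and x: "\<And>i. x i \<in> carrier G"
    and generates: "carrier G \<subseteq> generate G (x ` {..<d} \<union> A (Suc 0))"
  shows "index_le G (lower_central G (Suc c)) (iter_comm G (A e) c) (p ^ (num_basic_comms (Suc c) d * e))"
proof -
  interpret B: p_filtration G p "\<lambda>i. iter_comm G (A i) c"
    by (rule p_filtration_iter_comm) (rule p_filtration_axioms)
  interpret K: generated_mod G "A (Suc 0)" d x
  proof (intro generated_mod.intro generated_mod_axioms.intro is_group normal_A x generates)
    show "\<langle>g, h\<rangle> \<in> A (Suc 0)" if "g \<in> carrier G" "h \<in> carrier G" for g h
      using commutator_in[of g 0 h] that A0 by simp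
  qed
  let ?B = "{w. basic_comm d w \<and> weight w = Suc c}"
  let ?S = "eval_comm G x ` ?B" and ?K = "iter_comm G (A (Suc 0)) c"
  have \<Gamma>: "lower_central G (Suc c) = iter_comm G (A 0) c" by (simp add: lower_central_def A0)
  have K: "?K = K.M (Suc c)" by (simp add: K.M_def)
  have card: "card ?S \<le> num_basic_comms (Suc c) d"
    unfolding num_basic_comms_def by (intro card_image_le finite_basic_comms)
  have "index_le G (generate G (?S \<union> ?K)) ?K (p ^ card ?S)"
  proof (rule index_le_generate[OF B.normal_A normal_imp_subgroup[OF B.normal_A[of 0]] B.decreasing])
    show "0 < p" using prime_gt_0_nat[OF prime] .
    show "\<langle>g, h\<rangle> \<in> ?K" if "g \<in> iter_comm G (A 0) c" "h \<in> iter_comm G (A 0) c" for g h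
      using B.commutator_in[OF that(1) B.A_carrier[OF that(2)]] .
    show "g [^] p \<in> ?K" if "g \<in> iter_comm G (A 0) c" for g
      using B.power_in[OF that] .
    show "finite ?S" using finite_basic_comms by simp
    show "?S \<subseteq> iter_comm G (A 0) c"
    proof
      fix g assume "g \<in> ?S"
      then obtain w where "g = eval_comm G x w" "weight w = Suc c" by blast
      then show "g \<in> iter_comm G (A 0) c" using K.ev_in_\<Gamma>[of w] \<Gamma> by simp
    qed
  qed
  moreover have "iter_comm G (A 0) c \<subseteq> generate G (?S \<union> ?K)"
    using K.lower_central_subset_basic_span[of "Suc c"] by (simp add: K.basic_span_def \<Gamma> K)
  ultimately have "index_le G (iter_comm G (A 0) c) ?K (p ^ num_basic_comms (Suc c) d)"
    by (rule index_le_mono) (use card prime_ge_1_nat[OF prime] in \<open>simp add: power_increasing\<close>)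
  from B.index_le_iterated[OF this, of e] show ?thesis
    by (simp add: \<Gamma> power_mult)
qed

lemma (in group) min_generators_generate:
  assumes "finite (carrier G)"
  obtains y :: "nat \<Rightarrow> 'a" where "\<And>i. y i \<in> carrier G"
    "generate G (y ` {..<min_generators G}) = carrier G"
proof -
  let ?P = "\<lambda>n. \<exists>S. S \<subseteq> carrier G \<and> finite S \<and> card S = n \<and> generate G S = carrier G"
  have "generate G (carrier G) = carrier G"
    using generateI[OF subgroup_self order_refl] by simp
  then have "?P (card (carrier G))" using assms by (intro exI[of _ "carrier G"]) simp
  then have "?P (LEAST n. ?P n)" by (rule LeastI[of ?P])
  then obtain S where S: "S \<subseteq> carrier G" "finite S" "card S = min_generators G" "generate G S = carrier G"
    unfolding min_generators_def by blast
  obtain f where f: "bij_betw f {..<card S} S"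
    using ex_bij_betw_nat_finite[OF S(2)] by (auto simp: atLeast0LessThan)
  show ?thesis
  (* Only the values below d matter; the default keeps the others in the carrier. *)
  proof (rule that[of "\<lambda>i. if i < card S then f i else \<one>"])
    show "(if i < card S then f i else \<one>) \<in> carrier G" for i
      using f S(1) by (auto simp: bij_betw_def)
    have "(\<lambda>i. if i < card S then f i else \<one>) ` {..<card S} = S"
      using f by (auto simp: bij_betw_def)
    then show "generate G ((\<lambda>i. if i < card S then f i else \<one>) ` {..<min_generators G}) = carrier G"
      using S(3,4) by simp
  qed
qed

lemma (in group) pow_group_exp:
  assumes "finite (carrier G)" "x \<in> carrier G"
  shows "x [^] group_exp G = \<one>"
proof -
  let ?P = "\<lambda>n::nat. 0 < n \<and> (\<forall>x\<in>carrier G. x [^] n = \<one>)"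
  have "?P (order G)" using assms(1) pow_order_eq_1 order_gt_0_iff_finite by blast
  then have "?P (LEAST n. ?P n)" by (rule LeastI[of ?P])
  then show ?thesis using assms(2) by (simp add: group_exp_def)
qed

lemma free_presentation_hom:
  assumes "free_presentation X F R G" "group G"
  obtains \<phi> where "group_hom F G \<phi>" "\<phi> ` carrier F = carrier G" "R = {x \<in> carrier F. \<phi> x = \<one>\<^bsub>G\<^esub>}"
proof -
  interpret G: group G by fact
  interpret F: group F using assms by (simp add: free_presentation_def)
  interpret R: normal R F using assms by (simp add: free_presentation_def)
  obtain \<psi> where \<psi>: "\<psi> \<in> iso (F Mod R) G"
    using assms by (auto simp: free_presentation_def is_iso_def)
  then have hom: "\<psi> \<in> hom (F Mod R) G" and bij: "bij_betw \<psi> (carrier (F Mod R)) (carrier G)"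
    by (simp_all add: iso_def)
  interpret \<psi>: group_hom "F Mod R" G \<psi>
    using hom R.factorgroup_is_group G.is_group by (simp add: group_hom_def group_hom_axioms_def)
  show ?thesis
  proof
    show "group_hom F G (\<psi> \<circ> (#>\<^bsub>F\<^esub>) R)"
      using Group.hom_compose[OF R.r_coset_hom_Mod hom] F.is_group G.is_group
      by (simp add: group_hom_def group_hom_axioms_def)
    show "(\<psi> \<circ> (#>\<^bsub>F\<^esub>) R) ` carrier F = carrier G"
      using bij unfolding image_comp[symmetric] carrier_FactGroup[symmetric] by (simp add: bij_betw_def)
    have "\<psi> (R #>\<^bsub>F\<^esub> x) = \<one>\<^bsub>G\<^esub> \<longleftrightarrow> x \<in> R" if "x \<in> carrier F" for x
    proof -
      have "\<psi> (R #>\<^bsub>F\<^esub> x) = \<one>\<^bsub>G\<^esub> \<longleftrightarrow> \<psi> (R #>\<^bsub>F\<^esub> x) = \<psi> \<one>\<^bsub>F Mod R\<^esub>"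
        using \<psi>.hom_one by simp
      also have "\<dots> \<longleftrightarrow> R #>\<^bsub>F\<^esub> x = \<one>\<^bsub>F Mod R\<^esub>"
        using inj_on_eq_iff[OF bij_betw_imp_inj_on[OF bij] R.Q.hom_closed[OF that] R.Q.H.one_closed] .
      finally show ?thesis using R.coset_eq_one_iff[OF that] by simp
    qed
    then show "R = {x \<in> carrier F. (\<psi> \<circ> (#>\<^bsub>F\<^esub>) R) x = \<one>\<^bsub>G\<^esub>}" using R.subset by auto
  qed
qed

lemma (in group_hom) generate_preimage:
  assumes y: "\<And>i. y i \<in> carrier G" and N: "{g \<in> carrier G. h g = \<one>\<^bsub>H\<^esub>} \<subseteq> N"
    and gen: "generate H ((\<lambda>i. h (y i)) ` I) = carrier H"
  shows "carrier G \<subseteq> generate G (y ` I \<union> N)"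
proof
  fix g assume g: "g \<in> carrier G"
  have yI: "y ` I \<subseteq> carrier G" using y by blast
  have "h ` generate G (y ` I) = carrier H"
    using generate_img[OF yI] gen by (simp add: image_image)
  then obtain w where w: "w \<in> generate G (y ` I)" "h g = h w" using g by (metis hom_closed imageE)
  have wG: "w \<in> carrier G" using w(1) G.generate_in_carrier[OF yI] by blast
  have "h (g \<otimes> inv w) = \<one>\<^bsub>H\<^esub>" using g wG w(2) by simp
  then have "g \<otimes> inv w \<in> N" using g wG by (intro subsetD[OF N]) simp
  then have "g \<otimes> inv w \<in> generate G (y ` I \<union> N)" by (intro generate.incl) blast
  moreover have "w \<in> generate G (y ` I \<union> N)"
    by (rule subsetD[OF G.mono_generate w(1)]) simp
  ultimately have "(g \<otimes> inv w) \<otimes> w \<in> generate G (y ` I \<union> N)" by (rule generate.eng)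
  then show "g \<in> generate G (y ` I \<union> N)" using g wG by (simp add: G.m_assoc)
qed

theorem proposition3p4:
  fixes p c d e :: nat
    and G :: "('g, 'n) monoid_scheme"
    and F :: "('f, 'm) monoid_scheme"
    and X :: "'x set"
    and R :: "'f set"
  assumes "Factorial_Ring.prime p"
    and "1 \<le> c"
    and "finite_p_group p G"
    and "powerful p G"
    and "min_generators G = d"
    and "group_exp G = p ^ e"
    and "free_presentation X F R G"
  shows "finite (carrier (nilpotent_multiplier F R c)) \<and>
         card (carrier (nilpotent_multiplier F R c)) \<le> p ^ (num_basic_comms (c + 1) d * e)"
proof -
  interpret G: group G using assms(3) by (simp add: finite_p_group_def)
  have finG: "finite (carrier G)" using assms(3) by (simp add: finite_p_group_def)
  obtain \<phi> where "group_hom F G \<phi>" and surj: "\<phi> ` carrier F = carrier G"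
    and R: "R = {x \<in> carrier F. \<phi> x = \<one>\<^bsub>G\<^esub>}"
    using free_presentation_hom[OF assms(7) G.is_group] .
  then interpret \<phi>: group_hom F G \<phi> by simp
  let ?A = "\<lambda>i. {x \<in> carrier F. \<phi> x \<in> power_series p G i}"
  interpret A: p_filtration F p ?A
    by (rule \<phi>.p_filtration_preimage[OF powerful_p_filtration[OF assms(1,3,4)] surj])
  have "power_series p G e = {\<one>\<^bsub>G\<^esub>}"
    using G.pow_group_exp[OF finG] assms(6)
    by (intro G.power_series_trivial assms) simp
  then have Ae: "?A e = R" using R by auto
  obtain y where y: "\<And>i. y i \<in> carrier G" "generate G (y ` {..<d}) = carrier G"
    using G.min_generators_generate[OF finG] assms(5) by metis
  have "\<exists>x\<in>carrier F. \<phi> x = y i" for i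
  proof -
    have "y i \<in> \<phi> ` carrier F" using y(1) surj by simp
    then show ?thesis by (metis imageE)
  qed
  then obtain x where x: "\<And>i. x i \<in> carrier F" "\<And>i. \<phi> (x i) = y i" by metis
  have "index_le F (lower_central F (Suc c)) (iter_comm F (?A e) c) (p ^ (num_basic_comms (Suc c) d * e))"
  proof (rule A.index_le_lower_central[OF _ x(1)])
    show "carrier F \<subseteq> generate F (x ` {..<d} \<union> ?A (Suc 0))"
    proof (rule \<phi>.generate_preimage[OF x(1)])
      show "{g \<in> carrier F. \<phi> g = \<one>\<^bsub>G\<^esub>} \<subseteq> ?A (Suc 0)"
        using normal_imp_subgroup[OF G.power_series_normal] subgroup.one_closed by fastforce
    qed (simp add: x(2) y(2))
  qed auto
  then have "index_le F (R \<inter> lower_central F (c + 1)) (iter_comm F R c) (p ^ (num_basic_comms (c + 1) d * e))"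
    unfolding Ae Suc_eq_plus1 by (rule index_le_mono[OF _ Int_lower2 order_refl])
  moreover have "carrier (nilpotent_multiplier F R c)
      = (#>\<^bsub>F\<^esub>) (iter_comm F R c) ` (R \<inter> lower_central F (c + 1))"
    by (simp add: nilpotent_multiplier_def carrier_FactGroup r_coset_def)
  ultimately show ?thesis by (simp add: index_le_def)
qed

end
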